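(* Fix constants $g_{++},g_{00},g_{--}>0$ (independent of $q$), defining the Hermitian metric $g=\mathrm{diag}(g_{++},g_{00},g_{--})$ on $\Omega^1\mathbb C_q[SU_2]$. For every real $q\neq 0$ with $q^2\ne 1$, consider the set of all left invariant, right $\mathbb{CZ}$-invariant bimodule covariant derivatives $\nabla$ on $\Omega^1\mathbb C_q[SU_2]$ that preserve the metric $g$, are torsion compatible and are star compatible. This set contains precisely four connections that are torsion free. Of these four just one, having $r=0$ and a particular choice of $n_+$, has a limit as $q\to 1$ (in the sense that its coefficients $r,\nu,\mu,n_\pm,m_\pm$ converge; uniqueness is meant for $q$ sufficiently close to $1$), and, when $g_{++}=g_{--}$ (the case in which the metric is a real Riemannian metric at $q=1$), the limit is the classical Levi-Civita connection of $g$ on $SU_2$.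
   Context: **Algebra and calculus.** Let $q\in\mathbb R$, $q\ne0$, $q^2\neq1$. $A=\mathbb C_q[SU_2]$ is the unital $*$-algebra with generators $a,b,c,d$ and relations $ba=qab$, $ca=qac$, $db=qbd$, $dc=qcd$, $cb=bc$, $da-ad=q(1-q^{-2})bc$, $ad-q^{-1}bc=1$, with $a^*=d$, $d^*=a$, $c^*=-qb$, $b^*=-q^{-1}c$. Its 3D calculus: $\Omega^1A$ is the free left $A$-module on $e^+,e^0,e^-$, with bimodule relations $e^\pm a=qae^\pm$, $e^\pm c=qce^\pm$, $e^\pm b=q^{-1}be^\pm$, $e^\pm d=q^{-1}de^\pm$, $e^0a=q^2ae^0$, $e^0c=q^2ce^0$, $e^0b=q^{-2}be^0$, $e^0d=q^{-2}de^0$, and derivation $\mathrm d:A\to\Omega^1A$, $\mathrm da=ae^0+qbe^+$, $\mathrm db=ae^--q^{-2}be^0$, $\mathrm dc=ce^0+qde^+$, $\mathrm dd=ce^--q^{-2}de^0$. The star on $\Omega^1A$ is antilinear with $(x\xi y)^*=y^*\xi^*x^*$, $(e^0)^*=-e^0$, $(e^+)^*=-q^{-1}e^-$, $(e^-)^*=-qe^+$. In $\Omega^2A$: $e^\pm\wedge e^\pm=e^0\wedge e^0=0$, $q^2e^+\wedge e^-+e^-\wedge e^+=0$, $e^0\wedge e^\pm+q^{\pm4}e^\pm\wedge e^0=0$ (so $\Omega^2A$ is free on $e^+\wedge e^-,e^+\wedge e^0,e^-\wedge e^0$), and $\mathrm de^0=q^3e^+\wedge e^-$, $\mathrm de^\pm=\mp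 q^{\pm2}(1+q^{-2})e^\pm\wedge e^0$. **Connections.** A bimodule covariant derivative on $\Omega^1A$ is a linear map $\nabla:\Omega^1A\to\Omega^1A\otimes_A\Omega^1A$ with $\nabla(x\xi)=\mathrm dx\otimes\xi+x\nabla\xi$, together with a bimodule map $\sigma:\Omega^1A\otimes_A\Omega^1A\to\Omega^1A\otimes_A\Omega^1A$ with $\nabla(\xi x)=\nabla(\xi)x+\sigma(\xi\otimes\mathrm dx)$. The left invariant, right $\mathbb{CZ}$-invariant ones are those of the form (with $r,\nu,\mu,n_\pm,m_\pm\in\mathbb C$) $$\nabla e^0=r\,e^0\otimes e^0+\nu\,e^+\otimes e^-+\mu\,e^-\otimes e^+,\qquad \nabla e^\pm=n_\pm\,e^0\otimes e^\pm+m_\pm\,e^\pm\otimes e^0,$$ with $\sigma(e^0\otimes e^0)=(1+r(1-q^2))e^0\otimes e^0$, $\sigma(e^\pm\otimes e^0)=(1+(1-q^2)n_\pm)e^0\otimes e^\pm+(1-q^2)m_\pm e^\pm\otimes e^0$, $\sigma(e^0\otimes e^\pm)=q^{\pm4}e^\pm\otimes e^0$, $\sigma(e^{i}\otimes e^\pm)=q^{\pm2}e^\pm\otimes e^{i}$ for $i\in\{+,-\}$. **Conditions.** Torsion is $T=\wedge\nabla-\mathrm d:\Omega^1A\to\Omega^2A$; torsion free means $T=0$; torsion compatible means $\wedge\circ(\mathrm{id}+\sigma)=0$ (equivalently $T$ is a bimodule map). Star compatible means $\sigma$ is invertible and $\sigma\tau\sigma=\tau$, where $\tau(\xi\otimes\eta)=\eta^*\otimes\xi^*$.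 The metric $g=\mathrm{diag}(g_{++},g_{00},g_{--})$ (inverse matrix $g^{ij}$) is the Hermitian pairing $\langle xe^i,\overline{ye^j}\rangle=x\,g^{ij}y^*$-type structure determined by $\langle e^i,\overline{e^j}\rangle=g^{ij}$ and $\langle x\xi,\overline{y\eta}\rangle=x\langle\xi,\overline\eta\rangle y^*$. Writing $\nabla e^i=-\sum_k\Gamma^i_k\otimes e^k$, $\nabla$ preserves $g$ means $\sum_j\big((\Gamma^j_i)^*g_{jk}+g_{ij}\Gamma^j_k\big)=0$ for all $i,k\in\{+,0,-\}$ (this is the vanishing of the covariant derivative of $\sum_{i,j}\overline{e^j}g_{ji}\otimes e^i$). **Classical limit.** At $q=1$ the same formulas describe the commutative algebra of $SU_2$ with left invariant (complexified) 1-forms, antisymmetric wedge product, $\mathrm de^0=e^+\wedge e^-$, $\mathrm de^\pm=\mp2e^\pm\wedge e^0$, $(e^0)^*=-e^0$, $(e^\pm)^*=-e^\mp$. For $g_{++}=g_{--}$ the classical Levi-Civita connection of $g$ is the unique left invariant, right circle-invariant connection (i.e. of the form $\nabla e^0=r\,e^0\otimes e^0+\nu\,e^+\otimes e^-+\mu\,e^-\otimes e^+$, $\nabla e^\pm=n_\pm\,e^0\otimes e^\pm+m_\pm\,e^\pm\otimes e^0$ with $r,\nu,\mu,n_\pm,m_\pm\in\mathbb C$) that is torsion free, preserves $g$, and satisfies $\nabla(\xi^* )=\nabla(\xi)^{*\otimes *}$. *)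

theory Defs
  imports
    Complex_Main
    "HOL-Library.Poly_Mapping"
    "HOL-Algebra.QuotRing"
    "HOL-Algebra.Algebraic_Closure_Type"
begin

section \<open>The algebra \<open>\<complex>\<^sub>q[SU\<^sub>2]\<close>\<close>

text \<open>Under concatenation the words in the generators form the free monoid, so the finitely
  supported functions \<open>gen list \<Rightarrow>\<^sub>0 complex\<close>, with their convolution product, are the free unital
  complex algebra on the generators.\<close>

instantiation list :: (type) monoid_add
begin

definition zero_list :: "'a list" where "zero_list = []"

definition plus_list :: "'a list \<Rightarrow> 'a list \<Rightarrow> 'a list" where "plus_list xs ys = xs @ ys"

instance by standard (simp_all add: zero_list_def plus_list_def)

end

datatype gen = Gen_a | Gen_b | Gen_c | Gen_d

type_synonym free_alg = "gen list \<Rightarrow>\<^sub>0 complex"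

abbreviation Free :: "free_alg ring" where "Free \<equiv> ring_of_type_algebra"

definition const :: "complex \<Rightarrow> free_alg" where
  "const z = Poly_Mapping.single [] z"

definition word :: "gen list \<Rightarrow> free_alg" where
  "word w = Poly_Mapping.single w 1"

definition gen :: "gen \<Rightarrow> free_alg" where
  "gen x = word [x]"

definition relators :: "real \<Rightarrow> free_alg set" where
  "relators q =
    (let a = gen Gen_a; b = gen Gen_b; c = gen Gen_c; d = gen Gen_d; k = \<lambda>t. const (of_real t) in
      {b * a - k q * a * b,
       c * a - k q * a * c,
       d * b - k q * b * d,
       d * c - k q * c * d,
       c * b - b * c,
       d * a - a * d - k (q * (1 - q powi (-2))) * b * c,
       a * d - k (q powi (-1)) * b * c - 1})"

definition rel_ideal :: "real \<Rightarrow> free_alg set" where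
  "rel_ideal q = Idl\<^bsub>Free\<^esub> (relators q)"

type_synonym alg = "free_alg set"

definition SU :: "real \<Rightarrow> alg ring" where
  "SU q = Free Quot (rel_ideal q)"

definition cls :: "real \<Rightarrow> free_alg \<Rightarrow> alg" where
  "cls q x = rel_ideal q +>\<^bsub>Free\<^esub> x"

definition scalar :: "real \<Rightarrow> complex \<Rightarrow> alg" where
  "scalar q z = cls q (const z)"

text \<open>The map of quotients induced by a map \<open>h\<close> of the free algebra that is compatible with the
  ideal of relations; below, \<open>h\<close> is the star, a twist or a component of the derivation.\<close>

definition induced :: "real \<Rightarrow> (free_alg \<Rightarrow> free_alg) \<Rightarrow> alg \<Rightarrow> alg" where
  "induced q h A = (\<Union>x\<in>A. cls q (h x))"

fun star_gen :: "real \<Rightarrow> gen \<Rightarrow> free_alg" where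
  "star_gen q Gen_a = gen Gen_d"
| "star_gen q Gen_b = const (of_real (- (q powi (-1)))) * gen Gen_c"
| "star_gen q Gen_c = const (of_real (- q)) * gen Gen_b"
| "star_gen q Gen_d = gen Gen_a"

definition star_free :: "real \<Rightarrow> free_alg \<Rightarrow> free_alg" where
  "star_free q f =
    (\<Sum>w\<in>Poly_Mapping.keys f.
       const (cnj (Poly_Mapping.lookup f w)) * prod_list (map (star_gen q) (rev w)))"

definition star :: "real \<Rightarrow> alg \<Rightarrow> alg" where
  "star q = induced q (star_free q)"


section \<open>The 3D calculus\<close>

datatype idx = Plus | Zero | Minus

text \<open>An element \<open>s\<close> of the free left module with basis indexed by \<open>'k\<close> is the family of its left
  coefficients. As \<open>\<Omega>\<^sup>1\<close> is free on the \<open>e\<^sup>i\<close>, the left module \<open>\<Omega>\<^sup>1 \<otimes>\<^sub>A \<Omega>\<^sup>1\<close> is free on the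
  \<open>e\<^sup>i \<otimes> e\<^sup>j\<close>.\<close>

type_synonym form1 = "idx \<Rightarrow> alg"
type_synonym form11 = "idx \<times> idx \<Rightarrow> alg"

definition free_mod :: "real \<Rightarrow> ('k \<Rightarrow> alg) set" where
  "free_mod q = {s. \<forall>k. s k \<in> carrier (SU q)}"

definition plus_mod :: "real \<Rightarrow> ('k \<Rightarrow> alg) \<Rightarrow> ('k \<Rightarrow> alg) \<Rightarrow> 'k \<Rightarrow> alg" where
  "plus_mod q s t = (\<lambda>k. s k \<oplus>\<^bsub>SU q\<^esub> t k)"

definition lact :: "real \<Rightarrow> alg \<Rightarrow> ('k \<Rightarrow> alg) \<Rightarrow> 'k \<Rightarrow> alg" where
  "lact q x s = (\<lambda>k. x \<otimes>\<^bsub>SU q\<^esub> s k)"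

definition smult :: "real \<Rightarrow> complex \<Rightarrow> ('k \<Rightarrow> alg) \<Rightarrow> 'k \<Rightarrow> alg" where
  "smult q z s = lact q (scalar q z) s"

definition inv_elem :: "real \<Rightarrow> ('k \<Rightarrow> complex) \<Rightarrow> 'k \<Rightarrow> alg" where
  "inv_elem q z = (\<lambda>k. scalar q (z k))"

definition zero_mod :: "real \<Rightarrow> 'k \<Rightarrow> alg" where
  "zero_mod q = inv_elem q (\<lambda>_. 0)"

definition e_basis :: "real \<Rightarrow> idx \<Rightarrow> form1" where
  "e_basis q i = inv_elem q ((\<lambda>_. 0)(i := 1))"

text \<open>The bimodule relations say \<open>e\<^sup>i x = \<phi>\<^sub>i(x) e\<^sup>i\<close> for the algebra automorphism \<open>\<phi>\<^sub>i\<close> that scales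
  \<open>a, c\<close> by \<open>q\<close> and \<open>b, d\<close> by \<open>q\<^sup>-\<^sup>1\<close> if \<open>i = \<plusminus>\<close>, and by the squares of these factors if \<open>i = 0\<close>.\<close>

fun weight :: "gen \<Rightarrow> int" where
  "weight Gen_a = 1"
| "weight Gen_b = -1"
| "weight Gen_c = 1"
| "weight Gen_d = -1"

fun twist_degree :: "idx \<Rightarrow> int" where
  "twist_degree Plus = 1"
| "twist_degree Zero = 2"
| "twist_degree Minus = 1"

definition twist_free :: "real \<Rightarrow> idx \<Rightarrow> free_alg \<Rightarrow> free_alg" where
  "twist_free q i = Poly_Mapping.mapp
     (\<lambda>w z. of_real (q powi (twist_degree i * sum_list (map weight w))) * z)"

definition twist :: "real \<Rightarrow> idx \<Rightarrow> alg \<Rightarrow> alg" where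
  "twist q i = induced q (twist_free q i)"

definition ract1 :: "real \<Rightarrow> form1 \<Rightarrow> alg \<Rightarrow> form1" where
  "ract1 q \<xi> x = (\<lambda>i. \<xi> i \<otimes>\<^bsub>SU q\<^esub> twist q i x)"

definition ract11 :: "real \<Rightarrow> form11 \<Rightarrow> alg \<Rightarrow> form11" where
  "ract11 q t x = (\<lambda>(i, j). t (i, j) \<otimes>\<^bsub>SU q\<^esub> twist q i (twist q j x))"

text \<open>\<open>x e\<^sup>i \<otimes> y e\<^sup>j = x \<phi>\<^sub>i(y) e\<^sup>i \<otimes> e\<^sup>j\<close>.\<close>

definition tens :: "real \<Rightarrow> form1 \<Rightarrow> form1 \<Rightarrow> form11" where
  "tens q \<xi> \<eta> = (\<lambda>(i, j). \<xi> i \<otimes>\<^bsub>SU q\<^esub> twist q i (\<eta> j))"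

fun d_gen :: "real \<Rightarrow> gen \<Rightarrow> idx \<Rightarrow> free_alg" where
  "d_gen q Gen_a = (\<lambda>_. 0)(Zero := gen Gen_a, Plus := const (of_real q) * gen Gen_b)"
| "d_gen q Gen_b = (\<lambda>_. 0)(Minus := gen Gen_a, Zero := const (of_real (- (q powi (-2)))) * gen Gen_b)"
| "d_gen q Gen_c = (\<lambda>_. 0)(Zero := gen Gen_c, Plus := const (of_real q) * gen Gen_d)"
| "d_gen q Gen_d = (\<lambda>_. 0)(Minus := gen Gen_c, Zero := const (of_real (- (q powi (-2)))) * gen Gen_d)"

text \<open>The derivation on words, by the Leibniz rule \<open>d(x w) = (dx) w + x dw\<close>.\<close>

fun d_word :: "real \<Rightarrow> gen list \<Rightarrow> idx \<Rightarrow> free_alg" where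
  "d_word q [] i = 0"
| "d_word q (x # w) i = d_gen q x i * twist_free q i (word w) + gen x * d_word q w i"

definition d_free :: "real \<Rightarrow> idx \<Rightarrow> free_alg \<Rightarrow> free_alg" where
  "d_free q i f = (\<Sum>w\<in>Poly_Mapping.keys f. const (Poly_Mapping.lookup f w) * d_word q w i)"

definition d0 :: "real \<Rightarrow> alg \<Rightarrow> form1" where
  "d0 q x = (\<lambda>i. induced q (d_free q i) x)"

text \<open>The stars of the basis forms, and \<open>(\<Sum>\<^sub>i x\<^sub>i e\<^sup>i)\<^sup>* = \<Sum>\<^sub>i (e\<^sup>i)\<^sup>* x\<^sub>i\<^sup>*\<close>.\<close>

fun e_star :: "real \<Rightarrow> idx \<Rightarrow> form1" where
  "e_star q Plus = inv_elem q ((\<lambda>_. 0)(Minus := of_real (- (q powi (-1)))))"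
| "e_star q Zero = inv_elem q ((\<lambda>_. 0)(Zero := - 1))"
| "e_star q Minus = inv_elem q ((\<lambda>_. 0)(Plus := of_real (- q)))"

definition star1 :: "real \<Rightarrow> form1 \<Rightarrow> form1" where
  "star1 q \<xi> = (\<lambda>k. \<Oplus>\<^bsub>SU q\<^esub>i\<in>UNIV. ract1 q (e_star q i) (star q (\<xi> i)) k)"

text \<open>\<open>\<tau>(\<xi> \<otimes> \<eta>) = \<eta>\<^sup>* \<otimes> \<xi>\<^sup>*\<close> and \<open>(\<xi> \<otimes> \<eta>)\<^sup>*\<^sup>\<otimes>\<^sup>* = \<xi>\<^sup>* \<otimes> \<eta>\<^sup>*\<close>, for the tensor
  \<open>t = \<Sum>\<^sub>i\<^sub>j (t\<^sub>i\<^sub>j e\<^sup>i) \<otimes> e\<^sup>j\<close>. The second is well defined only for \<open>q = 1\<close>, where it is used.\<close>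

definition tau :: "real \<Rightarrow> form11 \<Rightarrow> form11" where
  "tau q t = (\<lambda>k. \<Oplus>\<^bsub>SU q\<^esub>i\<in>UNIV. \<Oplus>\<^bsub>SU q\<^esub>j\<in>UNIV.
     tens q (star1 q (e_basis q j)) (star1 q (lact q (t (i, j)) (e_basis q i))) k)"

definition star_tens :: "real \<Rightarrow> form11 \<Rightarrow> form11" where
  "star_tens q t = (\<lambda>k. \<Oplus>\<^bsub>SU q\<^esub>i\<in>UNIV. \<Oplus>\<^bsub>SU q\<^esub>j\<in>UNIV.
     tens q (star1 q (lact q (t (i, j)) (e_basis q i))) (star1 q (e_basis q j)) k)"

text \<open>\<open>\<Omega>\<^sup>2\<close> is free on \<open>e\<^sup>+ \<and> e\<^sup>-\<close>, \<open>e\<^sup>+ \<and> e\<^sup>0\<close>, \<open>e\<^sup>- \<and> e\<^sup>0\<close>; the coefficients in \<open>wedge\<close> come from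
  \<open>e\<^sup>- \<and> e\<^sup>+ = - q\<^sup>2 e\<^sup>+ \<and> e\<^sup>-\<close> and \<open>e\<^sup>0 \<and> e\<^sup>\<plusminus> = - q\<^sup>\<plusminus>\<^sup>4 e\<^sup>\<plusminus> \<and> e\<^sup>0\<close>.\<close>

datatype idx2 = Plus_Minus | Plus_Zero | Minus_Zero

type_synonym form2 = "idx2 \<Rightarrow> alg"

fun wedge :: "real \<Rightarrow> form11 \<Rightarrow> form2" where
  "wedge q t Plus_Minus = t (Plus, Minus)
     \<oplus>\<^bsub>SU q\<^esub> scalar q (of_real (- (q ^ 2))) \<otimes>\<^bsub>SU q\<^esub> t (Minus, Plus)"
| "wedge q t Plus_Zero = t (Plus, Zero)
     \<oplus>\<^bsub>SU q\<^esub> scalar q (of_real (- (q ^ 4))) \<otimes>\<^bsub>SU q\<^esub> t (Zero, Plus)"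
| "wedge q t Minus_Zero = t (Minus, Zero)
     \<oplus>\<^bsub>SU q\<^esub> scalar q (of_real (- (q powi (-4)))) \<otimes>\<^bsub>SU q\<^esub> t (Zero, Minus)"

fun d_e :: "real \<Rightarrow> idx \<Rightarrow> form2" where
  "d_e q Plus = inv_elem q ((\<lambda>_. 0)(Plus_Zero := of_real (- (q ^ 2 * (1 + q powi (-2))))))"
| "d_e q Zero = inv_elem q ((\<lambda>_. 0)(Plus_Minus := of_real (q ^ 3)))"
| "d_e q Minus = inv_elem q ((\<lambda>_. 0)(Minus_Zero := of_real (q powi (-2) * (1 + q powi (-2)))))"

text \<open>\<open>d(\<Sum>\<^sub>i x\<^sub>i e\<^sup>i) = \<Sum>\<^sub>i (dx\<^sub>i \<and> e\<^sup>i + x\<^sub>i de\<^sup>i)\<close>.\<close>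

definition d1 :: "real \<Rightarrow> form1 \<Rightarrow> form2" where
  "d1 q \<xi> = (\<lambda>k. \<Oplus>\<^bsub>SU q\<^esub>i\<in>UNIV.
     wedge q (tens q (d0 q (\<xi> i)) (e_basis q i)) k \<oplus>\<^bsub>SU q\<^esub> lact q (\<xi> i) (d_e q i) k)"


section \<open>Connections\<close>

text \<open>Maps on \<open>\<Omega>\<^sup>1\<close> and on \<open>\<Omega>\<^sup>1 \<otimes>\<^sub>A \<Omega>\<^sup>1\<close> are taken extensional, so that equality of connections is
  equality of functions.\<close>

definition covariant_derivative :: "real \<Rightarrow> (form1 \<Rightarrow> form11) \<Rightarrow> bool" where
  "covariant_derivative q D \<longleftrightarrow>
     D \<in> free_mod q \<rightarrow>\<^sub>E free_mod q \<and>
     (\<forall>\<xi>\<in>free_mod q. \<forall>\<eta>\<in>free_mod q. D (plus_mod q \<xi> \<eta>) = plus_mod q (D \<xi>) (D \<eta>)) \<and>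
     (\<forall>z. \<forall>\<xi>\<in>free_mod q. D (smult q z \<xi>) = smult q z (D \<xi>)) \<and>
     (\<forall>x\<in>carrier (SU q). \<forall>\<xi>\<in>free_mod q.
        D (lact q x \<xi>) = plus_mod q (tens q (d0 q x) \<xi>) (lact q x (D \<xi>)))"

definition bimodule_map :: "real \<Rightarrow> (form11 \<Rightarrow> form11) \<Rightarrow> bool" where
  "bimodule_map q \<sigma> \<longleftrightarrow>
     \<sigma> \<in> free_mod q \<rightarrow>\<^sub>E free_mod q \<and>
     (\<forall>s\<in>free_mod q. \<forall>t\<in>free_mod q. \<sigma> (plus_mod q s t) = plus_mod q (\<sigma> s) (\<sigma> t)) \<and>
     (\<forall>x\<in>carrier (SU q). \<forall>t\<in>free_mod q.
        \<sigma> (lact q x t) = lact q x (\<sigma> t) \<and> \<sigma> (ract11 q t x) = ract11 q (\<sigma> t) x)"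

definition bimodule_covariant_derivative ::
    "real \<Rightarrow> (form1 \<Rightarrow> form11) \<Rightarrow> (form11 \<Rightarrow> form11) \<Rightarrow> bool" where
  "bimodule_covariant_derivative q D \<sigma> \<longleftrightarrow>
     covariant_derivative q D \<and> bimodule_map q \<sigma> \<and>
     (\<forall>x\<in>carrier (SU q). \<forall>\<xi>\<in>free_mod q.
        D (ract1 q \<xi> x) = plus_mod q (ract11 q (D \<xi>) x) (\<sigma> (tens q \<xi> (d0 q x))))"

text \<open>The coefficients \<open>r, \<nu>, \<mu>, n\<^sub>\<plusminus>, m\<^sub>\<plusminus>\<close> of a left invariant, right circle-invariant connection.\<close>

datatype coeff =
  Coeff_r | Coeff_nu | Coeff_mu | Coeff_n_plus | Coeff_n_minus | Coeff_m_plus | Coeff_m_minus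

fun nabla_matrix :: "(coeff \<Rightarrow> complex) \<Rightarrow> idx \<Rightarrow> idx \<times> idx \<Rightarrow> complex" where
  "nabla_matrix c Zero =
     (\<lambda>_. 0)((Zero, Zero) := c Coeff_r, (Plus, Minus) := c Coeff_nu, (Minus, Plus) := c Coeff_mu)"
| "nabla_matrix c Plus = (\<lambda>_. 0)((Zero, Plus) := c Coeff_n_plus, (Plus, Zero) := c Coeff_m_plus)"
| "nabla_matrix c Minus = (\<lambda>_. 0)((Zero, Minus) := c Coeff_n_minus, (Minus, Zero) := c Coeff_m_minus)"

definition has_coeffs :: "real \<Rightarrow> (coeff \<Rightarrow> complex) \<Rightarrow> (form1 \<Rightarrow> form11) \<Rightarrow> bool" where
  "has_coeffs q c D \<longleftrightarrow> (\<forall>i. D (e_basis q i) = inv_elem q (nabla_matrix c i))"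

fun sigma_matrix :: "real \<Rightarrow> (coeff \<Rightarrow> complex) \<Rightarrow> idx \<Rightarrow> idx \<Rightarrow> idx \<times> idx \<Rightarrow> complex" where
  "sigma_matrix q c Zero Zero = (\<lambda>_. 0)((Zero, Zero) := 1 + c Coeff_r * (1 - of_real q ^ 2))"
| "sigma_matrix q c Plus Zero = (\<lambda>_. 0)
     ((Zero, Plus) := 1 + (1 - of_real q ^ 2) * c Coeff_n_plus,
      (Plus, Zero) := (1 - of_real q ^ 2) * c Coeff_m_plus)"
| "sigma_matrix q c Minus Zero = (\<lambda>_. 0)
     ((Zero, Minus) := 1 + (1 - of_real q ^ 2) * c Coeff_n_minus,
      (Minus, Zero) := (1 - of_real q ^ 2) * c Coeff_m_minus)"
| "sigma_matrix q c Zero Plus = (\<lambda>_. 0)((Plus, Zero) := of_real (q ^ 4))"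
| "sigma_matrix q c Zero Minus = (\<lambda>_. 0)((Minus, Zero) := of_real (q powi (-4)))"
| "sigma_matrix q c i Plus = (\<lambda>_. 0)((Plus, i) := of_real (q ^ 2))"
| "sigma_matrix q c i Minus = (\<lambda>_. 0)((Minus, i) := of_real (q powi (-2)))"

definition invariant_bimodule_connection ::
    "real \<Rightarrow> (form1 \<Rightarrow> form11) \<Rightarrow> (form11 \<Rightarrow> form11) \<Rightarrow> bool" where
  "invariant_bimodule_connection q D \<sigma> \<longleftrightarrow>
     bimodule_covariant_derivative q D \<sigma> \<and>
     (\<exists>c. has_coeffs q c D \<and>
          (\<forall>i j. \<sigma> (tens q (e_basis q i) (e_basis q j)) = inv_elem q (sigma_matrix q c i j)))"

definition torsion_free :: "real \<Rightarrow> (form1 \<Rightarrow> form11) \<Rightarrow> bool" where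
  "torsion_free q D \<longleftrightarrow> (\<forall>\<xi>\<in>free_mod q. wedge q (D \<xi>) = d1 q \<xi>)"

definition torsion_compatible :: "real \<Rightarrow> (form11 \<Rightarrow> form11) \<Rightarrow> bool" where
  "torsion_compatible q \<sigma> \<longleftrightarrow> (\<forall>t\<in>free_mod q. wedge q (plus_mod q t (\<sigma> t)) = zero_mod q)"

definition star_compatible :: "real \<Rightarrow> (form11 \<Rightarrow> form11) \<Rightarrow> bool" where
  "star_compatible q \<sigma> \<longleftrightarrow>
     bij_betw \<sigma> (free_mod q) (free_mod q) \<and> (\<forall>t\<in>free_mod q. \<sigma> (tau q (\<sigma> t)) = tau q t)"

text \<open>The Christoffel forms, determined by \<open>\<nabla>e\<^sup>i = - \<Sum>\<^sub>k \<Gamma>\<^sup>i\<^sub>k \<otimes> e\<^sup>k\<close>.\<close>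

definition christoffel :: "real \<Rightarrow> (form1 \<Rightarrow> form11) \<Rightarrow> idx \<Rightarrow> idx \<Rightarrow> form1" where
  "christoffel q D i k = (\<lambda>j. \<ominus>\<^bsub>SU q\<^esub> D (e_basis q i) (j, k))"

definition metric_matrix :: "(idx \<Rightarrow> real) \<Rightarrow> idx \<Rightarrow> idx \<Rightarrow> complex" where
  "metric_matrix g i j = (if i = j then of_real (g i) else 0)"

definition preserves_metric :: "real \<Rightarrow> (idx \<Rightarrow> real) \<Rightarrow> (form1 \<Rightarrow> form11) \<Rightarrow> bool" where
  "preserves_metric q g D \<longleftrightarrow>
     (\<forall>i k. (\<lambda>l. \<Oplus>\<^bsub>SU q\<^esub>j\<in>UNIV.
         smult q (metric_matrix g j k) (star1 q (christoffel q D j i)) l \<oplus>\<^bsub>SU q\<^esub>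
         smult q (metric_matrix g i j) (christoffel q D j k) l) = zero_mod q)"

definition compatible_connections :: "real \<Rightarrow> (idx \<Rightarrow> real) \<Rightarrow> (form1 \<Rightarrow> form11) set" where
  "compatible_connections q g =
     {D. \<exists>\<sigma>. invariant_bimodule_connection q D \<sigma> \<and> preserves_metric q g D \<and>
          torsion_compatible q \<sigma> \<and> star_compatible q \<sigma>}"

text \<open>For \<open>q = 1\<close> the algebra \<open>SU q\<close> is the commutative coordinate algebra of \<open>SU\<^sub>2\<close> and the
  calculus is the classical one.\<close>

definition levi_civita :: "(idx \<Rightarrow> real) \<Rightarrow> (form1 \<Rightarrow> form11) \<Rightarrow> bool" where
  "levi_civita g D \<longleftrightarrow>
     covariant_derivative 1 D \<and> (\<exists>c. has_coeffs 1 c D) \<and>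
     torsion_free 1 D \<and> preserves_metric 1 g D \<and>
     (\<forall>\<xi>\<in>free_mod 1. D (star1 1 \<xi>) = star_tens 1 (D \<xi>))"

end

theory Submission
  imports Defs
begin

text \<open>Everything is computed on representatives in the free algebra: there the twists are algebra maps,
  the star is an antilinear antihomomorphism and the components of the derivation are twisted
  derivations, so only their action on the seven relators has to be checked in order to pass to the
  quotient, and the character \<open>a, d \<mapsto> 1\<close>, \<open>b, c \<mapsto> 0\<close> shows that scalars can be compared there.
  The identity \<open>(1 - q\<^sup>2) \<partial>\<^sub>0 x = x - \<phi>\<^sub>0(x)\<close> makes every choice of the coefficients
  \<open>r, \<nu>, \<mu>, n\<^sub>\<plusminus>, m\<^sub>\<plusminus>\<close> a bimodule connection, so the theorem becomes a statement about seven
  complex numbers.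

  Put \<open>s = 1 - q\<^sup>2\<close>. Star compatibility and metric preservation force the coefficients to be real and
  \<open>(1 + r s)\<^sup>2 = 1\<close>, so \<open>r \<in> {0, -2/s}\<close>. With \<open>x = 1 + s m\<^sub>+ = q\<^sup>4 (1 + s n\<^sub>+)\<close> they give
  \<open>1 + s m\<^sub>- = 1/x\<close>, and the remaining torsion equation is
  \<open>g\<^sub>+\<^sub>+ x\<^sup>2 - (g\<^sub>+\<^sub>+ - g\<^sub>-\<^sub>- - q\<^sup>2 s g\<^sub>0\<^sub>0) x - g\<^sub>-\<^sub>- = 0\<close>, which has one positive and one negative root.
  As \<open>q \<rightarrow> 1\<close> the value \<open>r = -2/s\<close> diverges, and \<open>m\<^sub>+ = (x - 1)/s\<close> stays bounded only for the positive
  root, where it equals \<open>- q\<^sup>2 g\<^sub>0\<^sub>0 x / (g\<^sub>+\<^sub>+ x + g\<^sub>-\<^sub>-)\<close>.\<close>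

section \<open>The free algebra\<close>

lemma const_0 [simp]: "const 0 = 0"
  by (simp add: const_def)

lemma const_1 [simp]: "const 1 = 1"
  by (metis const_def single_one zero_list_def)

lemma const_add: "const (x + y) = const x + const y"
  by (simp add: const_def single_add)

lemma const_uminus: "const (- x) = - const x"
  by (simp add: const_def single_uminus)

lemma const_diff: "const (x - y) = const x - const y"
  by (simp add: const_def single_diff)

lemma const_mult: "const (x * y) = const x * const y"
  by (simp add: const_def mult_single plus_list_def)

lemma const_word: "const z * word w = Poly_Mapping.single w z"
  by (simp add: const_def word_def mult_single plus_list_def)

lemma word_Nil [simp]: "word [] = 1"
  using const_1 by (simp add: word_def const_def)

lemma word_append: "word (u @ v) = word u * word v"
  by (simp add: word_def mult_single plus_list_def)

lemma word_Cons: "word (x # w) = gen x * word w"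
  using word_append[of "[x]" w] by (simp add: gen_def)

text \<open>Every element is the finite sum of its monomials, and zero is the monomial with
  coefficient 0. Identities between additive maps therefore need checking only on scalar multiples
  of words.\<close>

lemma free_alg_induct [case_names monom add]:
  assumes "\<And>z w. P (const z * word w)" and "\<And>x y. P x \<Longrightarrow> P y \<Longrightarrow> P (x + y)"
  shows "P x"
proof -
  have "x = (\<Sum>w\<in>Poly_Mapping.keys x. Poly_Mapping.single w (Poly_Mapping.lookup x w))"
    by (intro poly_mapping_eqI) (simp add: lookup_sum lookup_single when_def in_keys_iff)
  moreover have "P (\<Sum>w\<in>W. Poly_Mapping.single w (Poly_Mapping.lookup x w))" if "finite W" for W
    using that
  proof induction
    case empty
    show ?case using assms(1)[of 0 "[]"] by simp
  next
    case (insert w W)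
    then show ?case using assms(2)[OF assms(1)] by (simp add: const_word[symmetric])
  qed
  ultimately show ?thesis by (metis finite_keys)
qed

text \<open>Scalars sit on the empty word, the unit of concatenation, so only commutativity of the
  complex numbers enters.\<close>

lemma const_central: "x * const z = const z * x"
proof (induction x rule: free_alg_induct)
  case (monom y w)
  show ?case by (simp add: const_def word_def mult_single plus_list_def mult.commute)
qed (simp add: algebra_simps)

lemma const_left_commute: "x * (const z * y) = const z * (x * y)"
  by (metis const_central mult.assoc)

lemma const_const_mult: "const y * (const z * x) = const (y * z) * x"
  by (simp add: const_mult mult.assoc)

lemma const_mult_mult: "(const y * u) * (const z * v) = const (y * z) * (u * v)"
  by (simp only: const_mult mult.assoc const_left_commute[of u])

lemma monom_mult: "const y * word u * (const z * word v) = const (y * z) * word (u @ v)"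
  by (simp add: const_mult_mult word_append)

section \<open>Additive extension from words\<close>

text \<open>One scheme for several maps: \<open>H\<close> transforms the coefficients and
  \<open>F\<close> the words. Taking \<open>H\<close> merely additive admits the antilinear star,
  and a general target ring admits the character \<open>counit\<close>.\<close>

definition monomial_extension :: "(complex \<Rightarrow> 'b::ring_1) \<Rightarrow> (gen list \<Rightarrow> 'b) \<Rightarrow> free_alg \<Rightarrow> 'b" where
  "monomial_extension H F f = (\<Sum>w\<in>Poly_Mapping.keys f. H (Poly_Mapping.lookup f w) * F w)"

text \<open>The supports of \<open>f\<close>, \<open>g\<close> and \<open>f + g\<close> lie in one
  finite union; the extra terms vanish because additivity gives \<open>H 0 = 0\<close>.\<close>

lemma monomial_extension_add:
  assumes "\<And>x y. H (x + y) = H x + H y"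
  shows "monomial_extension H F (f + g) = monomial_extension H F f + monomial_extension H F g"
proof -
  have H0: "H 0 = 0" using assms[of 0 0] by simp
  let ?K = "Poly_Mapping.keys f \<union> Poly_Mapping.keys g"
  have *: "monomial_extension H F h = (\<Sum>w\<in>?K. H (Poly_Mapping.lookup h w) * F w)"
    if "Poly_Mapping.keys h \<subseteq> ?K" for h
    unfolding monomial_extension_def using that H0
    by (intro sum.mono_neutral_left) (auto simp: in_keys_iff)
  show ?thesis
    by (simp add: * keys_add lookup_add assms distrib_right sum.distrib)
qed

lemma monomial_extension_term:
  assumes "\<And>x y. H (x + y) = H x + H y"
  shows "monomial_extension H F (const z * word w) = H z * F w"
  using assms[of 0 0] by (simp add: const_word monomial_extension_def)

lemma star_free_eq:
  "star_free q = monomial_extension (\<lambda>z. const (cnj z)) (\<lambda>w. prod_list (map (star_gen q) (rev w)))"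
  by (simp add: fun_eq_iff star_free_def monomial_extension_def)

lemma d_free_eq: "d_free q i = monomial_extension const (\<lambda>w. d_word q w i)"
  by (simp add: fun_eq_iff d_free_def monomial_extension_def)

section \<open>Twists, derivation and star on the free algebra\<close>

abbreviation twist_factor :: "real \<Rightarrow> idx \<Rightarrow> gen list \<Rightarrow> real" where
  "twist_factor q i w \<equiv> q powi (twist_degree i * sum_list (map weight w))"

lemma lookup_twist_free:
  "Poly_Mapping.lookup (twist_free q i x) w = of_real (twist_factor q i w) * Poly_Mapping.lookup x
      w"
  by (simp add: twist_free_def Poly_Mapping.mapp.rep_eq when_def in_keys_iff)

lemma twist_free_add: "twist_free q i (x + y) = twist_free q i x + twist_free q i y"
  by (rule poly_mapping_eqI) (simp add: lookup_twist_free lookup_add distrib_left)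

lemma twist_free_term:
  "twist_free q i (const z * word w) = const (of_real (twist_factor q i w)) * (const z * word w)"
  unfolding const_const_mult unfolding const_word
  by (rule poly_mapping_eqI) (simp add: lookup_twist_free lookup_single when_def)

context
  fixes q :: real
  assumes q: "q \<noteq> 0"
begin

text \<open>Weights add under concatenation, and for \<open>q \<noteq> 0\<close> integer powers turn
  this sum into a product.\<close>

lemma twist_free_mult: "twist_free q i (x * y) = twist_free q i x * twist_free q i y"
proof (induction x rule: free_alg_induct)
  case (monom z u)
  show ?case
  proof (induction y rule: free_alg_induct)
    case (monom z' v)
    show ?case
      unfolding monom_mult twist_free_term const_const_mult
      using q by (simp add: power_int_add algebra_simps)
  qed (simp add: twist_free_add algebra_simps)
qed (simp add: twist_free_add algebra_simps)

end

lemma twist_free_const [simp]: "twist_free q i (const z) = const z"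
  using twist_free_term[of q i z "[]"] by simp

lemma twist_free_0 [simp]: "twist_free q i 0 = 0"
  using twist_free_const[of q i 0] by simp

lemma twist_free_1 [simp]: "twist_free q i 1 = 1"
  using twist_free_const[of q i 1] by simp

lemma twist_free_gen:
  "twist_free q i (gen x) = const (of_real (q powi (twist_degree i * weight x))) * gen x"
  using twist_free_term[of q i 1 "[x]"] by (simp add: gen_def)

lemma additive_0: "(\<And>x y. f (x + y) = f x + f y) \<Longrightarrow> f (0::'a::ab_group_add) = (0::'b::ab_group_add)"
  by (metis add_cancel_right_right)

lemma additive_uminus:
  "(\<And>x y. f (x + y) = f x + f y) \<Longrightarrow> f (- x::'a::ab_group_add) = - (f x::'b::ab_group_add)"
  by (metis add.right_inverse add_eq_0_iff additive_0)

lemma additive_diff: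
  "(\<And>x y. f (x + y) = f x + f y) \<Longrightarrow> f (x - y::'a::ab_group_add) = f x - (f y::'b::ab_group_add)"
  by (metis add_uminus_conv_diff additive_uminus)

lemma additive_sum:
  "(\<And>x y. f (x + y) = f x + f y) \<Longrightarrow>
    f (sum g S::'a::ab_group_add) = (\<Sum>k\<in>S. f (g k)::'b::ab_group_add)"
  by (induction S rule: infinite_finite_induct) (auto simp: additive_0)

lemmas twist_free_diff = additive_diff[of "twist_free q i" for q i, OF twist_free_add]

lemma d_free_add: "d_free q i (x + y) = d_free q i x + d_free q i y"
  unfolding d_free_eq by (rule monomial_extension_add) (simp add: const_add)

lemma d_free_term: "d_free q i (const z * word w) = const z * d_word q w i"
  unfolding d_free_eq by (rule monomial_extension_term) (simp add: const_add)

lemmas d_free_uminus = additive_uminus[of "d_free q i" for q i, OF d_free_add]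
lemmas d_free_diff = additive_diff[of "d_free q i" for q i, OF d_free_add]

lemma d_free_const [simp]: "d_free q i (const z) = 0"
  using d_free_term[of q i z "[]"] by simp

lemma d_free_0 [simp]: "d_free q i 0 = 0"
  using d_free_const[of q i 0] by simp

lemma d_free_1 [simp]: "d_free q i 1 = 0"
  using d_free_const[of q i 1] by simp

lemma d_free_gen: "d_free q i (gen x) = d_gen q x i"
  using d_free_term[of q i 1 "[x]"] by (simp add: gen_def)

context
  fixes q :: real
  assumes q: "q \<noteq> 0"
begin

text \<open>The recursion splits off a single letter; multiplicativity of the twist extends this to
  a split at any position.\<close>

lemma d_word_append:
  "d_word q (u @ v) i = d_word q u i * twist_free q i (word v) + word u * d_word q v i"
  by (induction u)
    (simp_all add: word_append word_Cons twist_free_mult[OF q] algebra_simps)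

text \<open>The twist of \<open>y\<close> arises from moving e^i to the right past \<open>y\<close>
  in the term (dx) y of the Leibniz rule.\<close>

lemma d_free_mult: "d_free q i (x * y) = d_free q i x * twist_free q i y + x * d_free q i y"
proof (induction x rule: free_alg_induct)
  case (monom z u)
  show ?case
  proof (induction y rule: free_alg_induct)
    case (monom z' v)
    have "const z * d_word q u i * twist_free q i (const z' * word v)
        = const (z * z') * (d_word q u i * twist_free q i (word v))"
      by (simp add: twist_free_mult[OF q] const_mult_mult)
    then show ?case
      unfolding monom_mult d_free_term d_word_append by (simp add: const_mult_mult distrib_left)
  qed (simp add: d_free_add twist_free_add algebra_simps)
qed (simp add: d_free_add algebra_simps)

end

lemma star_free_add: "star_free q (x + y) = star_free q x + star_free q y"
  unfolding star_free_eq by (rule monomial_extension_add) (simp add: const_add)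

lemma star_free_term:
  "star_free q (const z * word w) = const (cnj z) * prod_list (map (star_gen q) (rev w))"
  unfolding star_free_eq by (rule monomial_extension_term) (simp add: const_add)

lemmas star_free_uminus = additive_uminus[of "star_free q" for q, OF star_free_add]
lemmas star_free_diff = additive_diff[of "star_free q" for q, OF star_free_add]
lemmas star_free_sum = additive_sum[of "star_free q" for q, OF star_free_add]

lemma star_free_const [simp]: "star_free q (const z) = const (cnj z)"
  using star_free_term[of q z "[]"] by simp

lemma star_free_0 [simp]: "star_free q 0 = 0"
  using star_free_const[of q 0] by simp

lemma star_free_1 [simp]: "star_free q 1 = 1"
  using star_free_const[of q 1] by simp

lemma star_free_gen: "star_free q (gen x) = star_gen q x"
  using star_free_term[of q 1 "[x]"] by (simp add: gen_def)

lemma star_free_mult: "star_free q (x * y) = star_free q y * star_free q x"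
proof (induction x rule: free_alg_induct)
  case (monom z u)
  show ?case
  proof (induction y rule: free_alg_induct)
    case (monom z' v)
    show ?case
      unfolding monom_mult star_free_term by (simp add: const_mult_mult mult.commute)
  qed (simp add: star_free_add algebra_simps)
qed (simp add: star_free_add algebra_simps)


section \<open>The ideal of relations and its quotient\<close>

lemma ring_Free: "ring Free"
proof -
  have "\<exists>y. x + y = 0" for x :: free_alg
    by (rule exI[of _ "- x"]) simp
  then show ?thesis
    unfolding ring_of_type_algebra_def using add.right_inverse
    by unfold_locales (auto simp: algebra_simps Units_def)
qed

lemma Free_simps [simp]:
  "carrier Free = UNIV" "\<zero>\<^bsub>Free\<^esub> = 0" "\<one>\<^bsub>Free\<^esub> = 1"
  "x \<oplus>\<^bsub>Free\<^esub> y = x + y" "x \<otimes>\<^bsub>Free\<^esub> y = x * y"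
  by (simp_all add: ring_of_type_algebra_def)

lemma Free_uminus [simp]: "\<ominus>\<^bsub>Free\<^esub> x = - x"
proof -
  interpret ring Free by (rule ring_Free)
  show ?thesis by (rule minus_equality) simp_all
qed

lemma Free_minus [simp]: "x \<ominus>\<^bsub>Free\<^esub> y = x - y"
  by (simp add: a_minus_def)

lemma ideal_rel_ideal: "ideal (rel_ideal q) Free"
  unfolding rel_ideal_def by (rule ring.genideal_ideal[OF ring_Free]) simp

lemma relators_subset: "relators q \<subseteq> rel_ideal q"
  unfolding rel_ideal_def by (rule ring.genideal_self[OF ring_Free]) simp

context
  fixes q :: real
begin

interpretation ideal "rel_ideal q" Free
  by (rule ideal_rel_ideal)

lemma rel_ideal_0 [simp]: "0 \<in> rel_ideal q"
  using additive_subgroup.zero_closed[OF additive_subgroup_axioms] by simp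

lemma rel_ideal_add: "x \<in> rel_ideal q \<Longrightarrow> y \<in> rel_ideal q \<Longrightarrow> x + y \<in> rel_ideal q"
  using additive_subgroup.a_closed[OF additive_subgroup_axioms] by simp

lemma rel_ideal_lmult: "x \<in> rel_ideal q \<Longrightarrow> y * x \<in> rel_ideal q"
  using I_l_closed[of x y] by simp

lemma rel_ideal_rmult: "x \<in> rel_ideal q \<Longrightarrow> x * y \<in> rel_ideal q"
  using I_r_closed[of x y] by simp

lemma rel_ideal_uminus: "x \<in> rel_ideal q \<Longrightarrow> - x \<in> rel_ideal q"
  using rel_ideal_lmult[of x "-1"] by simp

text \<open>The elements satisfying \<open>P\<close> form a two-sided ideal that contains the
  relators, hence it contains the ideal they generate. Closure under negation is multiplication by
  -1.\<close>

lemma rel_ideal_induct [consumes 1, case_names relator zero add lmult rmult]: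
  assumes "x \<in> rel_ideal q"
    and "\<And>r. r \<in> relators q \<Longrightarrow> P r" and "P 0"
    and "\<And>x y. P x \<Longrightarrow> P y \<Longrightarrow> P (x + y)"
    and "\<And>x y. P x \<Longrightarrow> P (y * x)" and "\<And>x y. P x \<Longrightarrow> P (x * y)"
  shows "P x"
proof -
  have uminus: "P (- x)" if "P x" for x
    using assms(5)[OF that, of "-1"] by simp
  have "ideal {x. P x} Free"
  proof (rule idealI)
    show "subgroup {x. P x} (add_monoid Free)"
    proof
      fix x assume "x \<in> {x. P x}"
      then show "inv\<^bsub>add_monoid Free\<^esub> x \<in> {x. P x}"
        using uminus Free_uminus[of x] by (simp add: a_inv_def)
    qed (use assms(3,4) Free_simps in \<open>auto\<close>)
  qed (use assms(5,6) ring_Free in auto)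
  moreover have "relators q \<subseteq> {x. P x}" using assms(2) by auto
  ultimately have "rel_ideal q \<subseteq> {x. P x}"
    unfolding rel_ideal_def by (rule ring.genideal_minimal[OF ring_Free])
  then show ?thesis using assms(1) by auto
qed

lemma cls_eq_iff: "cls q x = cls q y \<longleftrightarrow> x - y \<in> rel_ideal q"
  unfolding cls_def
  using quotient_eq_iff_same_a_r_cos[OF ideal_axioms, of x y] by simp

lemma mem_cls_iff: "y \<in> cls q x \<longleftrightarrow> y - x \<in> rel_ideal q"
  by (auto simp: cls_def a_r_coset_def r_coset_def intro: rev_bexI[of "y - x"])

lemma carrier_SU: "carrier (SU q) = range (cls q)"
  by (auto simp: SU_def FactRing_def A_RCOSETS_defs cls_def a_r_coset_def)

lemma cls_in_carrier [simp]: "cls q x \<in> carrier (SU q)"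
  by (simp add: carrier_SU)

lemma ring_SU: "ring (SU q)"
  unfolding SU_def by (rule quotient_is_ring)

lemma cls_add [simp]: "cls q x \<oplus>\<^bsub>SU q\<^esub> cls q y = cls q (x + y)"
  using ring_hom_add[OF rcos_ring_hom, of x y] by (simp add: cls_def SU_def)

lemma cls_mult [simp]: "cls q x \<otimes>\<^bsub>SU q\<^esub> cls q y = cls q (x * y)"
  using ring_hom_mult[OF rcos_ring_hom, of x y] by (simp add: cls_def SU_def)

lemma cls_zero: "\<zero>\<^bsub>SU q\<^esub> = cls q 0"
  using ring_hom_zero[OF rcos_ring_hom ring_Free quotient_is_ring] by (simp add: cls_def SU_def)

lemma cls_uminus [simp]: "\<ominus>\<^bsub>SU q\<^esub> cls q x = cls q (- x)"
proof -
  interpret S: ring "SU q" by (rule ring_SU)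
  show ?thesis by (rule S.minus_equality) (simp_all add: cls_zero)
qed

lemma cls_finsum [simp]: "(\<Oplus>\<^bsub>SU q\<^esub>i\<in>S. cls q (f i)) = cls q (\<Sum>i\<in>S. f i)" if "finite S"
proof -
  interpret S: ring "SU q" by (rule ring_SU)
  show ?thesis using that by induction (simp_all add: cls_zero)
qed

text \<open>An additive map that preserves the ideal sends each coset into one coset, so the union
  defining \<open>induced\<close> is a union of copies of a single class.\<close>

lemma induced_cls:
  assumes "\<And>x y. h (x + y) = h x + h y" and "\<And>x. x \<in> rel_ideal q \<Longrightarrow> h x \<in> rel_ideal q"
  shows "induced q h (cls q x) = cls q (h x)"
proof -
  have "cls q (h y) = cls q (h x)" if "y \<in> cls q x" for y
    using that assms(2)[of "y - x"] additive_diff[of h, OF assms(1)]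
    by (simp add: cls_eq_iff mem_cls_iff)
  moreover have "x \<in> cls q x" by (simp add: mem_cls_iff)
  ultimately show ?thesis unfolding induced_def by blast
qed

end

section \<open>A character of the quotient\<close>

text \<open>The counit of the Hopf algebra: a, d go to 1 and b, c go to 0, so a word survives
  exactly when it contains neither b nor c.\<close>

definition counit :: "free_alg \<Rightarrow> complex" where
  "counit = monomial_extension (\<lambda>z. z) (\<lambda>w. if set w \<subseteq> {Gen_a, Gen_d} then 1 else 0)"

lemma counit_add: "counit (x + y) = counit x + counit y"
  unfolding counit_def by (rule monomial_extension_add) simp

lemma counit_monom: "counit (const z * word w) = (if set w \<subseteq> {Gen_a, Gen_d} then z else 0)"
  unfolding counit_def by (simp add: monomial_extension_term)

lemma counit_mult: "counit (x * y) = counit x * counit y"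
proof (induction x rule: free_alg_induct)
  case (monom z u)
  show ?case
  proof (induction y rule: free_alg_induct)
    case (monom z' v)
    show ?case unfolding monom_mult counit_monom by simp
  qed (simp add: counit_add algebra_simps)
qed (simp add: counit_add algebra_simps)

lemma counit_const [simp]: "counit (const z) = z"
  using counit_monom[of z "[]"] by simp

text \<open>In the first five relators every term has a factor b or c; in the last two the remaining
  terms da - ad and ad - 1 cancel.\<close>

lemma counit_rel_ideal: "x \<in> rel_ideal q \<Longrightarrow> counit x = 0"
proof (induction rule: rel_ideal_induct)
  case (relator r)
  have "counit (gen Gen_a) = 1" "counit (gen Gen_b) = 0"
    "counit (gen Gen_c) = 0" "counit (gen Gen_d) = 1"
    using counit_monom[of 1 "[Gen_a]"] counit_monom[of 1 "[Gen_b]"]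
      counit_monom[of 1 "[Gen_c]"] counit_monom[of 1 "[Gen_d]"] by (simp_all add: gen_def)
  then show ?case
    using relator counit_const[of 1]
    by (auto simp: relators_def Let_def additive_diff[of counit, OF counit_add] counit_mult)
qed (use counit_const[of 0] in \<open>auto simp: counit_add counit_mult\<close>)

text \<open>This lets equations between invariant forms over the quotient be read as equations
  between complex coefficients.\<close>

lemma scalar_inject [simp]: "scalar q z = scalar q z' \<longleftrightarrow> z = z'"
proof
  assume "scalar q z = scalar q z'"
  then have "const (z - z') \<in> rel_ideal q"
    by (simp add: scalar_def cls_eq_iff const_diff)
  then show "z = z'" using counit_rel_ideal counit_const[of "z - z'"] by fastforce
qed simp

section \<open>Descent of the structure maps to the quotient\<close>

definition rel_ba :: "real \<Rightarrow> free_alg" where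
  "rel_ba q = gen Gen_b * gen Gen_a - const (of_real q) * gen Gen_a * gen Gen_b"
definition rel_ca :: "real \<Rightarrow> free_alg" where
  "rel_ca q = gen Gen_c * gen Gen_a - const (of_real q) * gen Gen_a * gen Gen_c"
definition rel_db :: "real \<Rightarrow> free_alg" where
  "rel_db q = gen Gen_d * gen Gen_b - const (of_real q) * gen Gen_b * gen Gen_d"
definition rel_dc :: "real \<Rightarrow> free_alg" where
  "rel_dc q = gen Gen_d * gen Gen_c - const (of_real q) * gen Gen_c * gen Gen_d"
definition rel_cb :: free_alg where
  "rel_cb = gen Gen_c * gen Gen_b - gen Gen_b * gen Gen_c"
definition rel_da :: "real \<Rightarrow> free_alg" where
  "rel_da q = gen Gen_d * gen Gen_a - gen Gen_a * gen Gen_d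
     - const (of_real (q * (1 - q powi (-2)))) * gen Gen_b * gen Gen_c"
definition rel_ad :: "real \<Rightarrow> free_alg" where
  "rel_ad q = gen Gen_a * gen Gen_d - const (of_real (q powi (-1))) * gen Gen_b * gen Gen_c - 1"

lemmas rel_defs = rel_ba_def rel_ca_def rel_db_def rel_dc_def rel_cb_def rel_da_def rel_ad_def

lemma relators_eq:
  "relators q = {rel_ba q, rel_ca q, rel_db q, rel_dc q, rel_cb, rel_da q, rel_ad q}"
  by (simp add: relators_def rel_defs Let_def)

lemma rel_mem_rel_ideal:
  "rel_ba q \<in> rel_ideal q" "rel_ca q \<in> rel_ideal q" "rel_db q \<in> rel_ideal q" "rel_dc q \<in> rel_ideal
      q"
  "rel_cb \<in> rel_ideal q" "rel_da q \<in> rel_ideal q" "rel_ad q \<in> rel_ideal q"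
  using relators_subset[of q] by (simp_all add: relators_eq)

lemmas free_eval = gen_def word_def const_def mult_single plus_list_def lookup_add lookup_minus
  lookup_uminus lookup_single lookup_one when_def zero_list_def algebra_simps

context
  fixes q :: real
  assumes q: "q \<noteq> 0"
begin

text \<open>Every relator is homogeneous for the weight: \<open>rel_ca\<close> has weight 2,
  \<open>rel_db\<close> has weight -2, the others have weight 0.\<close>

lemma twist_rel:
  "twist_free q i (rel_ba q) = rel_ba q"
  "twist_free q i (rel_ca q) = const (of_real (q powi (2 * twist_degree i))) * rel_ca q"
  "twist_free q i (rel_db q) = const (of_real (q powi (-2 * twist_degree i))) * rel_db q"
  "twist_free q i (rel_dc q) = rel_dc q"
  "twist_free q i rel_cb = rel_cb"
  "twist_free q i (rel_da q) = rel_da q"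
  "twist_free q i (rel_ad q) = rel_ad q"
  unfolding rel_defs twist_free_diff twist_free_mult[OF q] twist_free_gen twist_free_const
      twist_free_1
  by (rule poly_mapping_eqI, use q in \<open>cases i; simp add: free_eval power_int_minus;
        simp add: field_simps power2_eq_square eval_nat_numeral\<close>)+

lemma twist_free_rel_ideal: "x \<in> rel_ideal q \<Longrightarrow> twist_free q i x \<in> rel_ideal q"
proof (induction rule: rel_ideal_induct)
  case (relator r)
  then show ?case
    by (auto simp: relators_eq twist_rel intro!: rel_mem_rel_ideal rel_ideal_lmult)
qed (auto simp: twist_free_add twist_free_mult[OF q] intro: rel_ideal_add rel_ideal_lmult
    rel_ideal_rmult)

text \<open>A relator of weight n is multiplied by the q^2-number of n: 1 + q^2 for n = 2, its
  counterpart - (q^-4 + q^-2) for n = -2, and 0 for n = 0.\<close>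

lemma d_rel_Zero:
  "d_free q Zero (rel_ba q) = 0"
  "d_free q Zero (rel_ca q) = const (of_real (q^2 + 1)) * rel_ca q"
  "d_free q Zero (rel_db q) = const (of_real (- (q powi (-4) + q powi (-2)))) * rel_db q"
  "d_free q Zero (rel_dc q) = 0"
  "d_free q Zero rel_cb = 0"
  "d_free q Zero (rel_da q) = 0"
  "d_free q Zero (rel_ad q) = 0"
  unfolding rel_defs d_free_diff d_free_mult[OF q] d_free_gen twist_free_gen d_free_const d_free_1
      twist_free_const twist_free_mult[OF q]
  by (rule poly_mapping_eqI, use q in \<open>simp add: free_eval power_int_minus;
        simp add: field_simps power2_eq_square eval_nat_numeral\<close>)+

text \<open>The e^+ component turns a into b and c into d, so it lowers the weight by 2: relators of
  weight 0 yield multiples of \<open>rel_db\<close>, and \<open>rel_ca\<close> yields relators of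
  weight 0.\<close>

lemma d_rel_Plus:
  "d_free q Plus (rel_ba q) = 0"
  "d_free q Plus (rel_ca q) = const (of_real (q^2)) * rel_da q + const (of_real q) * rel_cb"
  "d_free q Plus (rel_db q) = 0"
  "d_free q Plus (rel_dc q) = 0"
  "d_free q Plus rel_cb = rel_db q"
  "d_free q Plus (rel_da q) = const (of_real q) * rel_db q"
  "d_free q Plus (rel_ad q) = 0"
  unfolding rel_defs d_free_diff d_free_mult[OF q] d_free_gen twist_free_gen d_free_const d_free_1
      twist_free_const twist_free_mult[OF q]
  by (rule poly_mapping_eqI, use q in \<open>simp add: free_eval power_int_minus;
        simp add: field_simps power2_eq_square eval_nat_numeral\<close>)+

text \<open>The mirror image: b becomes a and d becomes c, so the weight rises by 2 and
  \<open>rel_ca\<close> and \<open>rel_db\<close> exchange roles.\<close>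

lemma d_rel_Minus:
  "d_free q Minus (rel_ba q) = 0"
  "d_free q Minus (rel_ca q) = 0"
  "d_free q Minus (rel_db q) = rel_da q + const (of_real (q powi (-1))) * rel_cb"
  "d_free q Minus (rel_dc q) = 0"
  "d_free q Minus rel_cb = rel_ca q"
  "d_free q Minus (rel_da q) = const (of_real q) * rel_ca q"
  "d_free q Minus (rel_ad q) = 0"
  unfolding rel_defs d_free_diff d_free_mult[OF q] d_free_gen twist_free_gen d_free_const d_free_1
      twist_free_const twist_free_mult[OF q]
  by (rule poly_mapping_eqI, use q in \<open>simp add: free_eval power_int_minus;
        simp add: field_simps power2_eq_square eval_nat_numeral\<close>)+

lemma d_free_rel_ideal: "x \<in> rel_ideal q \<Longrightarrow> d_free q i x \<in> rel_ideal q"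
proof -
  have *: "d_free q i r \<in> rel_ideal q" if "r \<in> relators q" for r
    using that
    by (cases i) (auto simp: relators_eq d_rel_Zero d_rel_Plus d_rel_Minus
        intro!: rel_mem_rel_ideal rel_ideal_lmult rel_ideal_add)
  assume "x \<in> rel_ideal q"
  \<comment> \<open>Membership of \<open>x\<close> itself is carried along, because differentiating
    a product leaves terms in which \<open>x\<close> is only multiplied or twisted.\<close>
  then have "x \<in> rel_ideal q \<and> d_free q i x \<in> rel_ideal q"
  proof (induction rule: rel_ideal_induct)
    case (relator r)
    then show ?case using * relators_subset by blast
  qed (auto simp: d_free_add d_free_mult[OF q]
      intro: twist_free_rel_ideal rel_ideal_add rel_ideal_lmult rel_ideal_rmult)
  then show ?thesis ..
qed

text \<open>The star exchanges a with d and, up to scalars, b with c, and it reverses products; thus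
  it permutes the relators up to scalars.\<close>

lemma star_rel:
  "star_free q (rel_ba q) = const (of_real (- (q powi (-1)))) * rel_dc q"
  "star_free q (rel_ca q) = const (of_real (- q)) * rel_db q"
  "star_free q (rel_db q) = const (of_real (- (q powi (-1)))) * rel_ca q"
  "star_free q (rel_dc q) = const (of_real (- q)) * rel_ba q"
  "star_free q rel_cb = rel_cb"
  "star_free q (rel_da q) = rel_da q"
  "star_free q (rel_ad q) = rel_ad q"
  unfolding rel_defs star_free_diff star_free_mult star_free_gen star_free_const star_free_1
  by (rule poly_mapping_eqI, use q in \<open>simp add: free_eval power_int_minus;
        simp add: field_simps power2_eq_square eval_nat_numeral\<close>)+

lemma star_free_rel_ideal: "x \<in> rel_ideal q \<Longrightarrow> star_free q x \<in> rel_ideal q"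
proof (induction rule: rel_ideal_induct)
  case (relator r)
  then show ?case
    by (auto simp: relators_eq star_rel intro!: rel_mem_rel_ideal rel_ideal_lmult)
qed (auto simp: star_free_add star_free_mult intro: rel_ideal_add rel_ideal_lmult rel_ideal_rmult)

lemma twist_cls [simp]: "twist q i (cls q x) = cls q (twist_free q i x)"
  unfolding twist_def by (rule induced_cls) (simp_all add: twist_free_add twist_free_rel_ideal)

lemma star_cls [simp]: "star q (cls q x) = cls q (star_free q x)"
  unfolding star_def by (rule induced_cls) (simp_all add: star_free_add star_free_rel_ideal)

lemma d0_cls [simp]: "d0 q (cls q x) = (\<lambda>i. cls q (d_free q i x))"
  unfolding d0_def fun_eq_iff
  by (intro allI induced_cls) (simp_all add: d_free_add d_free_rel_ideal)

end


section \<open>Representatives in free modules\<close>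

lemma UNIV_idx: "UNIV = {Plus, Zero, Minus}"
  using idx.exhaust by blast

instance idx :: finite
  by standard (simp add: UNIV_idx)

lemma sum_idx: "(\<Sum>i\<in>UNIV. f i) = f Plus + f Zero + (f Minus :: 'a::comm_monoid_add)"
  by (simp add: UNIV_idx add.assoc)

lemma all_idx: "(\<forall>i. P i) \<longleftrightarrow> P Plus \<and> P Zero \<and> P Minus"
  by (metis idx.exhaust)

lemma all_idx2: "(\<forall>i. P i) \<longleftrightarrow> P Plus_Minus \<and> P Plus_Zero \<and> P Minus_Zero"
  by (metis idx2.exhaust)

definition cls_fun :: "real \<Rightarrow> ('k \<Rightarrow> free_alg) \<Rightarrow> 'k \<Rightarrow> alg" where
  "cls_fun q x = (\<lambda>k. cls q (x k))"

lemma free_mod_eq: "free_mod q = range (cls_fun q)"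
proof -
  have "\<exists>x. s = cls_fun q x" if "\<forall>k. s k \<in> carrier (SU q)" for s :: "'k \<Rightarrow> alg"
  proof -
    have "\<forall>k. \<exists>x. s k = cls q x" using that by (auto simp: carrier_SU)
    then show ?thesis unfolding cls_fun_def by metis
  qed
  then have "free_mod q \<subseteq> range (cls_fun q)" unfolding free_mod_def by blast
  then show ?thesis by (auto simp: free_mod_def cls_fun_def)
qed

lemma cls_fun_in_free_mod [simp]: "cls_fun q x \<in> free_mod q"
  by (simp add: free_mod_eq)

lemma ball_free_mod: "(\<forall>s\<in>free_mod q. P s) \<longleftrightarrow> (\<forall>x. P (cls_fun q x))"
  by (auto simp: free_mod_eq)

lemma ball_carrier_SU: "(\<forall>s\<in>carrier (SU q). P s) \<longleftrightarrow> (\<forall>x. P (cls q x))"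
  by (auto simp: carrier_SU)

lemma plus_mod_cls_fun: "plus_mod q (cls_fun q x) (cls_fun q y) = cls_fun q (\<lambda>k. x k + y k)"
  by (simp add: plus_mod_def cls_fun_def)

lemma lact_cls_fun: "lact q (cls q a) (cls_fun q x) = cls_fun q (\<lambda>k. a * x k)"
  by (simp add: lact_def cls_fun_def)

lemma smult_cls_fun: "smult q z (cls_fun q x) = cls_fun q (\<lambda>k. const z * x k)"
  by (simp add: smult_def scalar_def lact_cls_fun)

lemma inv_elem_cls_fun: "inv_elem q z = cls_fun q (\<lambda>k. const (z k))"
  by (simp add: inv_elem_def scalar_def cls_fun_def)

lemma inv_elem_inject [simp]: "inv_elem q z = inv_elem q z' \<longleftrightarrow> z = z'"
  by (auto simp: inv_elem_def fun_eq_iff)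

lemma e_basis_cls_fun: "e_basis q i = cls_fun q (\<lambda>k. if k = i then 1 else 0)"
  unfolding e_basis_def inv_elem_cls_fun by (rule arg_cong[of _ _ "cls_fun q"]) auto

text \<open>An additive map is determined by its values on families with one nonzero coordinate. The
  induction starts from singletons, so that the value at zero never has to be discussed
  separately.\<close>

lemma additive_on_free_mod:
  fixes x :: "'k::finite \<Rightarrow> free_alg"
  assumes add: "\<And>s t. s \<in> free_mod q \<Longrightarrow> t \<in> free_mod q \<Longrightarrow> f (plus_mod q s t) = plus_mod q (f s) (f t)"
    and basis: "\<And>k a. f (cls_fun q (\<lambda>l. if l = k then a else 0)) = cls_fun q (\<beta> k a)"
  shows "f (cls_fun q x) = cls_fun q (\<lambda>l. \<Sum>k\<in>UNIV. \<beta> k (x k) l)"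
proof -
  have "f (cls_fun q (\<lambda>k. if k \<in> S then x k else 0)) = cls_fun q (\<lambda>l. \<Sum>k\<in>S. \<beta> k (x k) l)"
    if "finite S" "S \<noteq> {}" for S
    using that
  proof (induction S rule: finite_ne_induct)
    case (singleton k)
    have "(\<lambda>l. if l \<in> {k} then x l else 0) = (\<lambda>l. if l = k then x k else 0)" by auto
    then show ?case using basis[of k "x k"] by simp
  next
    case (insert k S)
    have eq: "cls_fun q (\<lambda>l. if l \<in> insert k S then x l else 0) =
        plus_mod q (cls_fun q (\<lambda>l. if l = k then x k else 0)) (cls_fun q (\<lambda>l. if l \<in> S then x l
            else 0))"
      using insert.hyps by (auto simp: plus_mod_cls_fun intro!: arg_cong[of _ _ "cls_fun q"])
    show ?case
      unfolding eq unfolding add[OF cls_fun_in_free_mod cls_fun_in_free_mod]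
      unfolding basis insert.IH plus_mod_cls_fun
      using insert.hyps by simp
  qed
  from this[of UNIV] show ?thesis by simp
qed

section \<open>Coordinate formulas for the operations on forms\<close>

text \<open>The involution for which the star of e^i is a multiple of the basis form indexed by
  \<open>bar i\<close>; the factor is \<open>star_coeff q i\<close>.\<close>

fun bar :: "idx \<Rightarrow> idx" where
  "bar Plus = Minus" | "bar Zero = Zero" | "bar Minus = Plus"

lemma bar_bar [simp]: "bar (bar i) = i"
  by (cases i) simp_all

lemma bar_eq_iff: "bar i = j \<longleftrightarrow> i = bar j"
  by auto

fun star_coeff :: "real \<Rightarrow> idx \<Rightarrow> real" where
  "star_coeff q Plus = - (q powi (-1))" | "star_coeff q Zero = - 1" | "star_coeff q Minus = - q"

lemma e_star_eq: "e_star q i = inv_elem q ((\<lambda>_. 0)(bar i := of_real (star_coeff q i)))"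
  by (cases i) simp_all

fun wedge_free :: "real \<Rightarrow> (idx \<times> idx \<Rightarrow> free_alg) \<Rightarrow> idx2 \<Rightarrow> free_alg" where
  "wedge_free q t Plus_Minus = t (Plus, Minus) - const (of_real (q ^ 2)) * t (Minus, Plus)"
| "wedge_free q t Plus_Zero = t (Plus, Zero) - const (of_real (q ^ 4)) * t (Zero, Plus)"
| "wedge_free q t Minus_Zero = t (Minus, Zero) - const (of_real (q powi (-4))) * t (Zero, Minus)"

lemma wedge_cls_fun: "wedge q (cls_fun q t) = cls_fun q (wedge_free q t)"
proof
  fix k show "wedge q (cls_fun q t) k = cls_fun q (wedge_free q t) k"
    by (cases k) (simp_all add: cls_fun_def scalar_def const_uminus)
qed

fun d_e_coeff :: "real \<Rightarrow> idx \<Rightarrow> idx2 \<Rightarrow> complex" where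
  "d_e_coeff q Plus = (\<lambda>_. 0)(Plus_Zero := of_real (- (q ^ 2 * (1 + q powi (-2)))))"
| "d_e_coeff q Zero = (\<lambda>_. 0)(Plus_Minus := of_real (q ^ 3))"
| "d_e_coeff q Minus = (\<lambda>_. 0)(Minus_Zero := of_real (q powi (-2) * (1 + q powi (-2))))"

lemma d_e_eq: "d_e q i = inv_elem q (d_e_coeff q i)"
  by (cases i) simp_all

text \<open>The formula forced by the left Leibniz rule: the coefficient of e^i tensor e^j collects
  the e^i component of the differential of the j-th coordinate and the prescribed constants in the
  values on the basis forms.\<close>

definition nabla_free :: "real \<Rightarrow> (coeff \<Rightarrow> complex) \<Rightarrow> (idx \<Rightarrow> free_alg) \<Rightarrow> idx \<times> idx \<Rightarrow> free_alg" where
  "nabla_free q c x = (\<lambda>(i, j). d_free q i (x j) + (\<Sum>k\<in>UNIV. x k * const (nabla_matrix c k (i,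
      j))))"

definition nabla :: "real \<Rightarrow> (coeff \<Rightarrow> complex) \<Rightarrow> form1 \<Rightarrow> form11" where
  "nabla q c = (\<lambda>\<xi>\<in>free_mod q. \<lambda>(i, j). d0 q (\<xi> j) i \<oplus>\<^bsub>SU q\<^esub>
     (\<Oplus>\<^bsub>SU q\<^esub>k\<in>UNIV. \<xi> k \<otimes>\<^bsub>SU q\<^esub> scalar q (nabla_matrix c k (i, j))))"

text \<open>The matrix is a parameter so that one construction serves both the braiding and its
  inverse.\<close>

definition matrix_map_free ::
    "(idx \<Rightarrow> idx \<Rightarrow> idx \<times> idx \<Rightarrow> complex) \<Rightarrow> (idx \<times> idx \<Rightarrow> free_alg) \<Rightarrow> idx \<times> idx \<Rightarrow> free_alg" where
  "matrix_map_free S t = (\<lambda>p. \<Sum>i\<in>UNIV. \<Sum>j\<in>UNIV. t (i, j) * const (S i j p))"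

definition matrix_map :: "real \<Rightarrow> (idx \<Rightarrow> idx \<Rightarrow> idx \<times> idx \<Rightarrow> complex) \<Rightarrow> form11 \<Rightarrow> form11" where
  "matrix_map q S = (\<lambda>t\<in>free_mod q. \<lambda>p. \<Oplus>\<^bsub>SU q\<^esub>i\<in>UNIV. \<Oplus>\<^bsub>SU q\<^esub>j\<in>UNIV.
     t (i, j) \<otimes>\<^bsub>SU q\<^esub> scalar q (S i j p))"

abbreviation sigma :: "real \<Rightarrow> (coeff \<Rightarrow> complex) \<Rightarrow> form11 \<Rightarrow> form11" where
  "sigma q c \<equiv> matrix_map q (sigma_matrix q c)"

lemma matrix_map_cls_fun: "matrix_map q S (cls_fun q t) = cls_fun q (matrix_map_free S t)"
  by (simp add: matrix_map_def matrix_map_free_def cls_fun_def[of q t] cls_fun_def[of q "\<lambda>p. _ p"]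
      scalar_def
      cls_fun_in_free_mod[of q t, unfolded cls_fun_def])

text \<open>On a word the composite of two twists is a power of \<open>q\<close> that depends only
  on the sum of the two degrees.\<close>

lemma twist_free_twist_free:
  assumes "q \<noteq> 0" "twist_degree i + twist_degree j = twist_degree k + twist_degree l"
  shows "twist_free q i (twist_free q j x) = twist_free q k (twist_free q l x)"
proof (rule poly_mapping_eqI)
  fix w
  let ?n = "sum_list (map weight w)"
  have "q powi (twist_degree i * ?n) * q powi (twist_degree j * ?n)
      = q powi (twist_degree k * ?n) * q powi (twist_degree l * ?n)"
    using assms by (simp add: power_int_add[symmetric] distrib_right[symmetric])
  then have "of_real (q powi (twist_degree i * ?n)) * (of_real (q powi (twist_degree j * ?n)) ::
      complex)
      = of_real (q powi (twist_degree k * ?n)) * of_real (q powi (twist_degree l * ?n))"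
    by (metis of_real_mult)
  then show "Poly_Mapping.lookup (twist_free q i (twist_free q j x)) w
      = Poly_Mapping.lookup (twist_free q k (twist_free q l x)) w"
    by (simp add: lookup_twist_free mult.assoc[symmetric])
qed

text \<open>The braiding mixes only basis tensors of equal total degree, which is why it respects
  the right action.\<close>

lemma sigma_matrix_degree:
  "sigma_matrix q c i j (k, l) = 0 \<or> twist_degree i + twist_degree j = twist_degree k
      + twist_degree l"
  by (cases i; cases j; cases k; cases l; simp)

context
  fixes q :: real
  assumes q: "q \<noteq> 0"
begin

lemma tens_cls_fun:
  "tens q (cls_fun q x) (cls_fun q y) = cls_fun q (\<lambda>(i, j). x i * twist_free q i (y j))"
  using q by (auto simp: tens_def cls_fun_def)

lemma ract1_cls_fun: "ract1 q (cls_fun q x) (cls q a) = cls_fun q (\<lambda>i. x i * twist_free q i a)"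
  using q by (auto simp: ract1_def cls_fun_def)

lemma ract11_cls_fun:
  "ract11 q (cls_fun q t) (cls q a)
    = cls_fun q (\<lambda>(i, j). t (i, j) * twist_free q i (twist_free q j a))"
  using q by (auto simp: ract11_def cls_fun_def)

lemma d0_cls_fun: "d0 q (cls q a) = cls_fun q (\<lambda>i. d_free q i a)"
  using q by (simp add: cls_fun_def)

lemma star1_cls_fun:
  "star1 q (cls_fun q x) = cls_fun q (\<lambda>k. const (of_real (star_coeff q (bar k))) *
     twist_free q k (star_free q (x (bar k))))"
proof
  fix k
  have "star1 q (cls_fun q x) k = cls q (\<Sum>i\<in>UNIV. const (((\<lambda>_. 0)(bar i := of_real (star_coeff q
      i))) k) *
     twist_free q k (star_free q (x i)))"
    using q by (simp add: star1_def cls_fun_def ract1_def e_star_eq inv_elem_def scalar_def)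
  also have "\<dots> = cls_fun q (\<lambda>k. const (of_real (star_coeff q (bar k))) *
     twist_free q k (star_free q (x (bar k)))) k"
    by (cases k) (simp_all add: cls_fun_def sum_idx)
  finally show "star1 q (cls_fun q x) k = \<dots>" .
qed

text \<open>After the flip the starred coefficient stands to the right of both basis forms; moving
  it to the left past both produces two twists.\<close>

lemma tau_cls_fun:
  "tau q (cls_fun q t) = cls_fun q (\<lambda>(k, l). const (of_real (star_coeff q (bar k) * star_coeff q
      (bar l))) *
     twist_free q k (twist_free q l (star_free q (t (bar l, bar k)))))"
proof
  fix p :: "idx \<times> idx"
  obtain k l where p: "p = (k, l)" by fastforce
  show "tau q (cls_fun q t) p = cls_fun q (\<lambda>(k, l). const (of_real (star_coeff q (bar k) *
      star_coeff q (bar l))) *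
     twist_free q k (twist_free q l (star_free q (t (bar l, bar k))))) p"
    unfolding tau_def e_basis_cls_fun cls_fun_def[of q t] lact_cls_fun star1_cls_fun tens_cls_fun
    unfolding cls_fun_def p
    using q by (cases k; cases l) (simp_all add: sum_idx twist_free_mult const_const_mult
        const_mult[symmetric])
qed

text \<open>Without the flip the starred coefficient passes only the first basis form, so a single
  twist appears.\<close>

lemma star_tens_cls_fun:
  "star_tens q (cls_fun q t) = cls_fun q (\<lambda>(k, l). const (of_real (star_coeff q (bar k) *
      star_coeff q (bar l))) *
     twist_free q k (star_free q (t (bar k, bar l))))"
proof
  fix p :: "idx \<times> idx"
  obtain k l where p: "p = (k, l)" by fastforce
  show "star_tens q (cls_fun q t) p = cls_fun q (\<lambda>(k, l). const (of_real (star_coeff q (bar k) *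
      star_coeff q (bar l))) *
     twist_free q k (star_free q (t (bar k, bar l)))) p"
    unfolding star_tens_def e_basis_cls_fun cls_fun_def[of q t] lact_cls_fun star1_cls_fun
        tens_cls_fun
    unfolding cls_fun_def p
    using q by (cases k; cases l) (simp_all add: sum_idx twist_free_mult const_const_mult
        const_mult[symmetric]
        const_central[of "const u * v" for u v])
qed

lemma d1_cls_fun:
  "d1 q (cls_fun q x) = cls_fun q (\<lambda>k. \<Sum>i\<in>UNIV.
     wedge_free q (\<lambda>(a, b). d_free q a (x i) * (if b = i then 1 else 0)) k
         + x i * const (d_e_coeff q i k))"
proof -
  have *: "tens q (d0 q (cls_fun q x i)) (e_basis q i)
      = cls_fun q (\<lambda>(a, b). d_free q a (x i) * (if b = i then 1 else 0))" for i
    unfolding cls_fun_def[of q x] d0_cls_fun e_basis_cls_fun tens_cls_fun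
    by (intro arg_cong[of _ _ "cls_fun q"]) auto
  show ?thesis
    unfolding d1_def * wedge_cls_fun d_e_eq inv_elem_cls_fun
    unfolding cls_fun_def[of q x] lact_cls_fun
    by (simp add: cls_fun_def)
qed

lemma nabla_cls_fun: "nabla q c (cls_fun q x) = cls_fun q (nabla_free q c x)"
  using q by (auto simp: nabla_def nabla_free_def cls_fun_def[of q x] cls_fun_def[of q "\<lambda>p. _ p"]
      scalar_def
      cls_fun_in_free_mod[of q x, unfolded cls_fun_def])

end


section \<open>The connections and braidings with given coefficients\<close>

text \<open>The amount by which the i-th component of the derivation lowers the weight.\<close>

fun weight_shift :: "idx \<Rightarrow> int" where
  "weight_shift Plus = 2" | "weight_shift Zero = 0" | "weight_shift Minus = -2"

lemma twist_free_1_eq [simp]: "twist_free 1 i x = x"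
  by (rule poly_mapping_eqI) (simp add: lookup_twist_free)

text \<open>The component form of d commuting with the star at q = 1, where the star of each e^i is
  minus the basis form indexed by \<open>bar i\<close>. Both sides are derivations there, so the
  generators suffice.\<close>

lemma d_free_1_star: "d_free 1 i (star_free 1 x) = - star_free 1 (d_free 1 (bar i) x)"
proof (induction x rule: free_alg_induct)
  case (monom z w)
  have "d_free 1 i (star_free 1 (word w)) = - star_free 1 (d_free 1 (bar i) (word w))"
  proof (induction w)
    case (Cons x w)
    have "d_free 1 i (star_free 1 (gen x)) = - star_free 1 (d_free 1 (bar i) (gen x))"
      by (cases x; cases i)
        (simp_all add: star_free_gen d_free_gen d_free_mult star_free_mult const_uminus
            d_free_uminus star_free_uminus)
    with Cons show ?case
      by (simp add: word_Cons star_free_mult d_free_mult star_free_add)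
  qed simp
  then show ?case
    by (simp add: star_free_mult d_free_mult const_central)
qed (simp add: star_free_add d_free_add)

context
  fixes q :: real
  assumes q: "q \<noteq> 0"
begin

lemma d_free_const_mult: "d_free q i (const z * x) = const z * d_free q i x"
  by (simp add: d_free_mult[OF q])

lemma twist_free_const_mult: "twist_free q i (const z * x) = const z * twist_free q i x"
  by (simp add: twist_free_mult[OF q])

text \<open>The component \<open>\<partial>\<^sub>0\<close> of the derivation is the \<open>q\<^sup>2\<close>-number of the weight. This is why \<open>\<sigma>\<close> exists
  for every choice of the coefficients.\<close>

lemma d_free_Zero: "const (1 - of_real q ^ 2) * d_free q Zero x = x - twist_free q Zero x"
proof (induction x rule: free_alg_induct)
  case (monom z w)
  have "const (1 - of_real q ^ 2) * d_free q Zero (word w) = word w - twist_free q Zero (word w)"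
  proof (induction w)
    case (Cons x w)
    have "const (1 - of_real q ^ 2) * d_free q Zero (gen x) = gen x - twist_free q Zero (gen x)"
      unfolding d_free_gen twist_free_gen
      by (rule poly_mapping_eqI, use q in \<open>cases x; simp add: free_eval power_int_minus;
        simp add: field_simps power2_eq_square eval_nat_numeral\<close>)
    note gen = this
    let ?K = "const (1 - of_real q ^ 2)"
    \<comment> \<open>By the twisted Leibniz rule the two contributions telescope: (x - \<phi>(x))
      \<phi>(w) + x (w - \<phi>(w)) = x w - \<phi>(x) \<phi>(w), with \<phi> the twist of index
      \<open>Zero\<close>.\<close>
    have "?K * d_free q Zero (word (x # w))
      = ?K * d_free q Zero (gen x) * twist_free q Zero (word w)
          + gen x * (?K * d_free q Zero (word w))"
      unfolding word_Cons d_free_mult[OF q]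
      by (simp add: distrib_left const_left_commute[of "gen x"] mult.assoc)
    also have "\<dots> = gen x * word w - twist_free q Zero (gen x) * twist_free q Zero (word w)"
      unfolding Cons gen by (simp add: algebra_simps)
    finally show ?case unfolding word_Cons twist_free_mult[OF q] .
  qed simp
  then have "const z * (const (1 - of_real q ^ 2) * d_free q Zero (word w))
      = const z * (word w - twist_free q Zero (word w))" by simp
  then show ?case
    by (simp add: d_free_const_mult twist_free_const_mult const_const_mult mult.commute[of z]
        right_diff_distrib[of "const z"])
qed (simp add: d_free_add twist_free_add distrib_left)

text \<open>The twist scales by weight, and the derivation component changes the weight by a fixed
  amount; commuting them costs the corresponding power of \<open>q\<close>.\<close>

lemma d_free_twist_free:
  "d_free q i (twist_free q j x)
    = const (of_real (q powi (weight_shift i * twist_degree j))) * twist_free q j (d_free q i x)"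
proof (induction x rule: free_alg_induct)
  case (monom z w)
  let ?K = "const (of_real (q powi (weight_shift i * twist_degree j)))"
  have "d_free q i (twist_free q j (word w)) = ?K * twist_free q j (d_free q i (word w))"
  proof (induction w)
    case (Cons x w)
    have "d_free q i (twist_free q j (gen x)) = ?K * twist_free q j (d_free q i (gen x))"
      unfolding twist_free_gen d_free_const_mult d_free_gen
      by (use q in \<open>cases x; cases i; cases j; simp add: twist_free_gen twist_free_const_mult
          const_const_mult power_int_minus;
        (simp add: field_simps eval_nat_numeral)?\<close>)
    with Cons show ?case
      unfolding word_Cons d_free_mult[OF q] twist_free_mult[OF q] twist_free_add
      by (simp add: distrib_left const_left_commute[of "twist_free q j (gen x)"] mult.assoc
          twist_free_twist_free[OF q, of i j j i])
  qed simp
  then show ?case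
    by (simp add: d_free_const_mult twist_free_const_mult const_const_mult mult.commute[of z])
qed (simp add: d_free_add twist_free_add algebra_simps)

section \<open>Existence of a connection for each choice of coefficients\<close>

lemma nabla_covariant_derivative: "covariant_derivative q (nabla q c)"
  unfolding covariant_derivative_def ball_free_mod ball_carrier_SU
proof (intro conjI allI)
  show "nabla q c \<in> free_mod q \<rightarrow>\<^sub>E free_mod q"
    using nabla_cls_fun[OF q, of c] by (auto simp: free_mod_eq nabla_def)
next
  fix x y :: "idx \<Rightarrow> free_alg" and a z
  show "nabla q c (plus_mod q (cls_fun q x) (cls_fun q y))
      = plus_mod q (nabla q c (cls_fun q x)) (nabla q c (cls_fun q y))"
    unfolding plus_mod_cls_fun nabla_cls_fun[OF q]
    by (rule arg_cong[of _ _ "cls_fun q"])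
      (simp add: nabla_free_def fun_eq_iff d_free_add sum_idx algebra_simps)
  show "nabla q c (smult q z (cls_fun q x)) = smult q z (nabla q c (cls_fun q x))"
    unfolding smult_cls_fun nabla_cls_fun[OF q]
    by (rule arg_cong[of _ _ "cls_fun q"])
      (simp add: nabla_free_def fun_eq_iff d_free_const_mult sum_idx algebra_simps)
  show "nabla q c (lact q (cls q a) (cls_fun q x))
      = plus_mod q (tens q (d0 q (cls q a)) (cls_fun q x)) (lact q (cls q a) (nabla q c (cls_fun q
          x)))"
    unfolding lact_cls_fun nabla_cls_fun[OF q] d0_cls_fun[OF q] tens_cls_fun[OF q] plus_mod_cls_fun
    by (rule arg_cong[of _ _ "cls_fun q"])
      (simp add: nabla_free_def fun_eq_iff d_free_mult[OF q] sum_idx algebra_simps)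
qed

lemma sigma_twist: "const (sigma_matrix q c i j (k, l)) * twist_free q i (twist_free q j x)
    = const (sigma_matrix q c i j (k, l)) * twist_free q k (twist_free q l x)"
  using sigma_matrix_degree[of q c i j k l] twist_free_twist_free[OF q, of i j k l] by auto

lemma sigma_bimodule_map: "bimodule_map q (sigma q c)"
  unfolding bimodule_map_def ball_free_mod ball_carrier_SU
proof (intro conjI allI)
  show "sigma q c \<in> free_mod q \<rightarrow>\<^sub>E free_mod q"
    using matrix_map_cls_fun[of q "sigma_matrix q c"] by (auto simp: free_mod_eq matrix_map_def)
next
  fix s t :: "idx \<times> idx \<Rightarrow> free_alg" and a
  show "sigma q c (plus_mod q (cls_fun q s) (cls_fun q t))
      = plus_mod q (sigma q c (cls_fun q s)) (sigma q c (cls_fun q t))"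
    unfolding plus_mod_cls_fun matrix_map_cls_fun
    by (rule arg_cong[of _ _ "cls_fun q"])
      (simp add: matrix_map_free_def fun_eq_iff distrib_right sum.distrib)
  show "sigma q c (lact q (cls q a) (cls_fun q t)) = lact q (cls q a) (sigma q c (cls_fun q t))"
    unfolding lact_cls_fun matrix_map_cls_fun
    by (rule arg_cong[of _ _ "cls_fun q"])
      (simp add: matrix_map_free_def fun_eq_iff sum_distrib_left mult.assoc)
  show "sigma q c (ract11 q (cls_fun q t) (cls q a)) = ract11 q (sigma q c (cls_fun q t)) (cls q a)"
    unfolding ract11_cls_fun[OF q] matrix_map_cls_fun
    by (rule arg_cong[of _ _ "cls_fun q"])
      (simp add: matrix_map_free_def fun_eq_iff sum_distrib_right mult.assoc const_central[of
          "twist_free _ _ _"] sigma_twist)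
qed

text \<open>The right Leibniz rule for e^k a, read off at e^i tensor e^j: the left side is
  \<nabla>(e^k a) - \<nabla>(e^k) a with e^k a rewritten by the twist, the right side is
  \<sigma>(e^k tensor da).\<close>

lemma nabla_leibniz_basis:
  "(if k = j then d_free q i (twist_free q j a) else 0)
     + const (nabla_matrix c k (i, j)) * (twist_free q k a - twist_free q i (twist_free q j a))
   = (\<Sum>l\<in>UNIV. const (sigma_matrix q c k l (i, j)) * twist_free q k (d_free q l a))"
proof -
  \<comment> \<open>Here the factors 1 - q^2 of the braiding arise: a difference of twists that
    differ by the one of index \<open>Zero\<close> is that factor times a twisted
    derivative.\<close>
  have 0: "twist_free q k a - twist_free q k (twist_free q Zero a)
      = const (1 - of_real q ^ 2) * twist_free q k (d_free q Zero a)" for k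
    unfolding twist_free_diff[symmetric] d_free_Zero[symmetric] twist_free_const_mult ..
  \<comment> \<open>Two twists of degree 1 compose to the one of degree 2, so the difference
    multiplying \<nu> and \<mu> vanishes and these do not enter \<sigma>.\<close>
  have tw1: "twist_free q i (twist_free q j a) = twist_free q Zero a" if "i \<noteq> Zero" "j \<noteq> Zero" for
      i j
    using that q by (intro poly_mapping_eqI, cases i; cases j)
      (simp_all add: lookup_twist_free power_int_mult power2_eq_square power_int_mult_distrib)
  have tw2: "twist_free q Zero (twist_free q k a) = twist_free q k (twist_free q Zero a)" for k
    by (rule twist_free_twist_free[OF q]) simp
  show ?thesis
    by (cases k; cases i; cases j)
      (simp_all add: sum_idx d_free_twist_free tw1 tw2[of Plus] tw2[of Minus] 0 const_const_mult
          const_add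
        distrib_right mult.commute)
qed

text \<open>The right Leibniz rule follows from the case of the basis forms by multiplying with the
  coordinates from the left and summing.\<close>

lemma nabla_bimodule_covariant_derivative:
  "bimodule_covariant_derivative q (nabla q c) (sigma q c)"
  unfolding bimodule_covariant_derivative_def ball_free_mod ball_carrier_SU
proof (intro conjI allI nabla_covariant_derivative sigma_bimodule_map)
  fix a and x :: "idx \<Rightarrow> free_alg"
  have "nabla_free q c (\<lambda>i. x i * twist_free q i a) (i, j)
      = nabla_free q c x (i, j) * twist_free q i (twist_free q j a)
        + matrix_map_free (sigma_matrix q c) (\<lambda>(i, j). x i * twist_free q i (d_free q j a)) (i,
            j)" for i j
  proof -
    have "(\<Sum>k\<in>UNIV. x k * ((if k = j then d_free q i (twist_free q j a) else 0)
        + const (nabla_matrix c k (i, j)) * (twist_free q k a - twist_free q i (twist_free q j a))))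
      = (\<Sum>k\<in>UNIV. x k * (\<Sum>l\<in>UNIV. const (sigma_matrix q c k l (i,
          j)) * twist_free q k (d_free q l a)))"
      by (simp add: nabla_leibniz_basis)
    moreover have "(\<Sum>k\<in>UNIV. x k * (if k = j then y else 0)) = x j * y" for y
      by (cases j) (simp_all add: sum_idx)
    ultimately have "x j * d_free q i (twist_free q j a)
        + (\<Sum>k\<in>UNIV. x k * (const (nabla_matrix c k (i, j)) * twist_free q k a))
      = (\<Sum>k\<in>UNIV. x k * (const (nabla_matrix c k (i, j)) * twist_free q i (twist_free q j a)))
        + (\<Sum>k\<in>UNIV. \<Sum>l\<in>UNIV. x k * (const (sigma_matrix q c k l (i,
            j)) * twist_free q k (d_free q l a)))"
      by (simp add: distrib_left right_diff_distrib sum.distrib sum_subtractf sum_distrib_left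
          diff_eq_eq
          add_diff_eq)
    then show ?thesis
      by (simp add: nabla_free_def matrix_map_free_def d_free_mult[OF q] distrib_right
          sum_distrib_right
          mult.assoc const_central[of "twist_free _ _ _"] add.assoc)
  qed
  then show "nabla q c (ract1 q (cls_fun q x) (cls q a)) =
      plus_mod q (ract11 q (nabla q c (cls_fun q x)) (cls q a)) (sigma q c (tens q (cls_fun q x)
          (d0 q (cls q a))))"
    unfolding ract1_cls_fun[OF q] nabla_cls_fun[OF q] ract11_cls_fun[OF q] d0_cls_fun[OF q]
        tens_cls_fun[OF q]
      matrix_map_cls_fun plus_mod_cls_fun
    by (intro arg_cong[of _ _ "cls_fun q"]) auto
qed

lemma nabla_has_coeffs: "has_coeffs q c (nabla q c)"
proof -
  have "nabla_free q c (\<lambda>k. if k = i then 1 else 0) p = const (nabla_matrix c i p)" for i p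
    by (cases i; cases p) (simp_all add: nabla_free_def sum_idx)
  then show ?thesis
    unfolding has_coeffs_def e_basis_cls_fun nabla_cls_fun[OF q] inv_elem_cls_fun
    by (auto intro!: arg_cong[of _ _ "cls_fun q"])
qed

section \<open>Parametrization by the coefficients\<close>

text \<open>The left Leibniz rule gives the value on a e^k from the value on e^k, and additivity
  does the rest.\<close>

lemma nabla_unique:
  assumes "covariant_derivative q D" "has_coeffs q c D"
  shows "D = nabla q c"
proof (rule PiE_ext)
  note D = assms(1)[unfolded covariant_derivative_def]
  note N = nabla_covariant_derivative[of c, unfolded covariant_derivative_def]
  show "D \<in> free_mod q \<rightarrow>\<^sub>E free_mod q" "nabla q c \<in> free_mod q \<rightarrow>\<^sub>E free_mod q"
    using D N by auto
  fix \<xi> :: form1 assume "\<xi> \<in> free_mod q"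
  then obtain x where x: "\<xi> = cls_fun q x" by (auto simp: free_mod_eq)
  define \<beta> where "\<beta> = (\<lambda>k a. nabla_free q c (\<lambda>l. if l = k then a else 0))"
  have basis: "cls_fun q (\<lambda>l. if l = k then a else 0) = lact q (cls q a) (e_basis q k)" for k ::
      idx and a
    unfolding e_basis_cls_fun lact_cls_fun by (rule arg_cong[of _ _ "cls_fun q"]) auto
  have N_basis: "nabla q c (cls_fun q (\<lambda>l. if l = k then a else 0)) = cls_fun q (\<beta> k a)" for k a
    by (simp add: \<beta>_def nabla_cls_fun[OF q])
  have e: "e_basis q k \<in> free_mod q" for k by (simp add: e_basis_cls_fun)
  have "D (lact q (cls q a) (e_basis q k)) = nabla q c (lact q (cls q a) (e_basis q k))" for k a
    using D N e assms(2) nabla_has_coeffs[of c] by (simp add: has_coeffs_def)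
  then have D_basis: "D (cls_fun q (\<lambda>l. if l = k then a else 0)) = cls_fun q (\<beta> k a)" for k a
    using N_basis basis by simp
  show "D \<xi> = nabla q c \<xi>"
    unfolding x using additive_on_free_mod[of q D \<beta>, OF _ D_basis]
      additive_on_free_mod[of q "nabla q c" \<beta>, OF _ N_basis] D N by auto
qed

lemma sigma_basis:
  "sigma q c (tens q (e_basis q i) (e_basis q j)) = inv_elem q (sigma_matrix q c i j)"
proof -
  have "matrix_map_free (sigma_matrix q c) (\<lambda>(k, l). (if k
      = i then 1 else 0) * twist_free q k (if l = j then 1 else 0)) p
    = const (sigma_matrix q c i j p)" for p
    by (cases i; cases j) (simp_all add: matrix_map_free_def sum_idx)
  then show ?thesis
    unfolding e_basis_cls_fun tens_cls_fun[OF q] matrix_map_cls_fun inv_elem_cls_fun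
    by (auto intro!: arg_cong[of _ _ "cls_fun q"])
qed

lemma sigma_unique:
  assumes "bimodule_map q \<sigma>"
    and "\<And>i j. \<sigma> (tens q (e_basis q i) (e_basis q j)) = inv_elem q (sigma_matrix q c i j)"
  shows "\<sigma> = sigma q c"
proof (rule PiE_ext)
  note D = assms(1)[unfolded bimodule_map_def]
  note N = sigma_bimodule_map[of c, unfolded bimodule_map_def]
  show "\<sigma> \<in> free_mod q \<rightarrow>\<^sub>E free_mod q" "sigma q c \<in> free_mod q \<rightarrow>\<^sub>E free_mod q"
    using D N by auto
  fix t :: form11 assume "t \<in> free_mod q"
  then obtain x where x: "t = cls_fun q x" by (auto simp: free_mod_eq)
  define \<beta> where "\<beta> = (\<lambda>k a. matrix_map_free (sigma_matrix q c) (\<lambda>l. if l = k then a else 0))"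
  have e: "tens q (e_basis q i) (e_basis q j) = cls_fun q (\<lambda>l. if l = (i, j) then 1 else 0)" for i j
    unfolding e_basis_cls_fun tens_cls_fun[OF q] by (rule arg_cong[of _ _ "cls_fun q"]) auto
  have basis: "cls_fun q (\<lambda>l. if l = k then a else 0)
      = lact q (cls q a) (tens q (e_basis q (fst k)) (e_basis q (snd k)))" for k :: "idx \<times> idx"
          and a
    unfolding e lact_cls_fun by (rule arg_cong[of _ _ "cls_fun q"]) auto
  have N_basis: "sigma q c (cls_fun q (\<lambda>l. if l = k then a else 0)) = cls_fun q (\<beta> k a)" for k a
    by (simp add: \<beta>_def matrix_map_cls_fun)
  have "tens q (e_basis q i) (e_basis q j) \<in> free_mod q" for i j by (simp add: e)
  then have "\<sigma> (lact q (cls q a) (tens q (e_basis q i) (e_basis q j)))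
      = sigma q c (lact q (cls q a) (tens q (e_basis q i) (e_basis q j)))" for i j a
    using D N assms(2) sigma_basis[of c] by simp
  then have D_basis: "\<sigma> (cls_fun q (\<lambda>l. if l = k then a else 0)) = cls_fun q (\<beta> k a)" for k a
    using N_basis basis by simp
  show "\<sigma> t = sigma q c t"
    unfolding x using additive_on_free_mod[of q \<sigma> \<beta>, OF _ D_basis]
      additive_on_free_mod[of q "sigma q c" \<beta>, OF _ N_basis] D N by auto
qed

text \<open>From here on a connection together with its braiding is the same thing as seven complex
  numbers.\<close>

lemma invariant_bimodule_connection_iff:
  "invariant_bimodule_connection q D \<sigma> \<longleftrightarrow> (\<exists>c. D = nabla q c \<and> \<sigma> = sigma q c)"
  unfolding invariant_bimodule_connection_def
  using nabla_unique sigma_unique nabla_bimodule_covariant_derivative nabla_has_coeffs sigma_basis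
  by (metis bimodule_covariant_derivative_def)

lemma has_coeffs_nabla_iff: "has_coeffs q c' (nabla q c) \<longleftrightarrow> c' = c"
proof
  assume "has_coeffs q c' (nabla q c)"
  then have "nabla_matrix c' i = nabla_matrix c i" for i
    using nabla_has_coeffs[of c] by (simp add: has_coeffs_def)
  then have "nabla_matrix c' i p = nabla_matrix c i p" for i p by simp
  from this[of Zero "(Zero, Zero)"] this[of Zero "(Plus, Minus)"] this[of Zero "(Minus, Plus)"]
    this[of Plus "(Zero, Plus)"] this[of Plus "(Plus, Zero)"]
    this[of Minus "(Zero, Minus)"] this[of Minus "(Minus, Zero)"]
  have "c' k = c k" for k by (cases k) simp_all
  then show "c' = c" by auto
qed (simp add: nabla_has_coeffs)

end


section \<open>Torsion, metric and star compatibility in terms of the coefficients\<close>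

fun wedge_coeff :: "real \<Rightarrow> (idx \<times> idx \<Rightarrow> complex) \<Rightarrow> idx2 \<Rightarrow> complex" where
  "wedge_coeff q t Plus_Minus = t (Plus, Minus) - of_real (q ^ 2) * t (Minus, Plus)"
| "wedge_coeff q t Plus_Zero = t (Plus, Zero) - of_real (q ^ 4) * t (Zero, Plus)"
| "wedge_coeff q t Minus_Zero = t (Minus, Zero) - of_real (q powi (-4)) * t (Zero, Minus)"

lemma wedge_free_const: "wedge_free q (\<lambda>p. const (t p)) k = const (wedge_coeff q t k)"
  by (cases k) (simp_all add: const_diff const_mult)

lemma wedge_free_add: "wedge_free q (\<lambda>p. s p + t p) k = wedge_free q s k + wedge_free q t k"
  by (cases k) (simp_all add: algebra_simps)

lemma wedge_free_sum:
  "wedge_free q (\<lambda>p. \<Sum>i\<in>S. t i p) k = (\<Sum>i\<in>S. wedge_free q (t i) k)"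
  by (cases k) (simp_all add: sum_subtractf sum_distrib_left)

lemma wedge_free_mult_const:
  "wedge_free q (\<lambda>p. x * const (t p)) k = x * const (wedge_coeff q t k)"
  by (cases k) (simp_all add: const_diff const_mult right_diff_distrib const_left_commute[of x])

definition matrix_coeff ::
    "(idx \<Rightarrow> idx \<Rightarrow> idx \<times> idx \<Rightarrow> complex) \<Rightarrow> (idx \<times> idx \<Rightarrow> complex) \<Rightarrow> idx \<times> idx \<Rightarrow> complex" where
  "matrix_coeff S z p = (\<Sum>i\<in>UNIV. \<Sum>j\<in>UNIV. z (i, j) * S i j p)"

text \<open>The entries of the braiding that depend on the connection; all others are 0 or powers of
  \<open>q\<close>.\<close>

definition sigma_R :: "real \<Rightarrow> (coeff \<Rightarrow> complex) \<Rightarrow> complex" where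
  "sigma_R q c = 1 + c Coeff_r * (1 - of_real q ^ 2)"
definition sigma_N_plus :: "real \<Rightarrow> (coeff \<Rightarrow> complex) \<Rightarrow> complex" where
  "sigma_N_plus q c = 1 + (1 - of_real q ^ 2) * c Coeff_n_plus"
definition sigma_N_minus :: "real \<Rightarrow> (coeff \<Rightarrow> complex) \<Rightarrow> complex" where
  "sigma_N_minus q c = 1 + (1 - of_real q ^ 2) * c Coeff_n_minus"
definition sigma_M_plus :: "real \<Rightarrow> (coeff \<Rightarrow> complex) \<Rightarrow> complex" where
  "sigma_M_plus q c = (1 - of_real q ^ 2) * c Coeff_m_plus"
definition sigma_M_minus :: "real \<Rightarrow> (coeff \<Rightarrow> complex) \<Rightarrow> complex" where
  "sigma_M_minus q c = (1 - of_real q ^ 2) * c Coeff_m_minus"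

lemmas sigma_entries = sigma_R_def[symmetric] sigma_N_plus_def[symmetric]
    sigma_N_minus_def[symmetric]
  sigma_M_plus_def[symmetric] sigma_M_minus_def[symmetric]

text \<open>The braiding splits into the entry at e^0 tensor e^0, a two by two triangular-type block
  for each of e^+ and e^- paired with e^0, and a scaled permutation of the rest. Each piece is
  inverted separately; the quotients are meaningful when \<open>sigma_R\<close>,
  \<open>sigma_N_plus\<close> and \<open>sigma_N_minus\<close> do not vanish.\<close>

fun sigma_inverse_matrix :: "real \<Rightarrow> (coeff \<Rightarrow> complex) \<Rightarrow> idx \<Rightarrow> idx \<Rightarrow> idx \<times> idx \<Rightarrow> complex" where
  "sigma_inverse_matrix q c Zero Zero = (\<lambda>_. 0)((Zero, Zero) := 1 / sigma_R q c)"
| "sigma_inverse_matrix q c Plus Zero = (\<lambda>_. 0)((Zero, Plus) := of_real (q powi (-4)))"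
| "sigma_inverse_matrix q c Minus Zero = (\<lambda>_. 0)((Zero, Minus) := of_real (q ^ 4))"
| "sigma_inverse_matrix q c Zero Plus = (\<lambda>_. 0)((Plus, Zero) := 1 / sigma_N_plus q c,
     (Zero, Plus) := - (sigma_M_plus q c * of_real (q powi (-4))) / sigma_N_plus q c)"
| "sigma_inverse_matrix q c Zero Minus = (\<lambda>_. 0)((Minus, Zero) := 1 / sigma_N_minus q c,
     (Zero, Minus) := - (sigma_M_minus q c * of_real (q ^ 4)) / sigma_N_minus q c)"
| "sigma_inverse_matrix q c Plus i = (\<lambda>_. 0)((i, Plus) := of_real (q powi (-2)))"
| "sigma_inverse_matrix q c Minus i = (\<lambda>_. 0)((i, Minus) := of_real (q ^ 2))"

lemma all_idx_pair: "(\<forall>p. P p) \<longleftrightarrow> (\<forall>i j. P (i, j :: idx))" for P :: "idx \<times> idx \<Rightarrow> bool"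
  by simp

context
  fixes q :: real
  assumes q: "q \<noteq> 0"
begin

text \<open>The wedge of the connection and the exterior derivative obey the same left Leibniz rule,
  so the torsion is left linear and is determined on the basis forms.\<close>

lemma torsion_free_nabla_iff:
  "torsion_free q (nabla q c) \<longleftrightarrow> (\<forall>i. wedge_coeff q (nabla_matrix c i) = d_e_coeff q i)"
proof
  assume *: "\<forall>i. wedge_coeff q (nabla_matrix c i) = d_e_coeff q i"
  have "wedge_free q (nabla_free q c x) k = (\<Sum>i\<in>UNIV.
     wedge_free q (\<lambda>(a, b). d_free q a (x i) * (if b = i then 1 else 0)) k
         + x i * const (d_e_coeff q i k))" for x k
  proof -
    have "nabla_free q c x = (\<lambda>p. (\<Sum>i\<in>UNIV. (\<lambda>(a, b). d_free q a (x i) * (if b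
        = i then 1 else 0)) p)
        + (\<Sum>i\<in>UNIV. x i * const (nabla_matrix c i p)))"
    proof
      fix p :: "idx \<times> idx"
      show "nabla_free q c x p = (\<Sum>i\<in>UNIV. (\<lambda>(a, b). d_free q a (x i) * (if b = i then 1 else 0)) p)
        + (\<Sum>i\<in>UNIV. x i * const (nabla_matrix c i p))"
        by (cases p; cases "snd p") (simp_all add: nabla_free_def sum_idx)
    qed
    then show ?thesis
      by (simp only: wedge_free_add wedge_free_sum wedge_free_mult_const sum.distrib * )
  qed
  then show "torsion_free q (nabla q c)"
    unfolding torsion_free_def ball_free_mod nabla_cls_fun[OF q] wedge_cls_fun d1_cls_fun[OF q]
    by (auto intro: arg_cong[of _ _ "cls_fun q"])
next
  assume *: "torsion_free q (nabla q c)"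
  show "\<forall>i. wedge_coeff q (nabla_matrix c i) = d_e_coeff q i"
  proof
    fix i
    have 1: "wedge q (nabla q c (e_basis q i)) = inv_elem q (wedge_coeff q (nabla_matrix c i))"
      using nabla_has_coeffs[OF q, of c]
      by (simp add: has_coeffs_def inv_elem_cls_fun wedge_cls_fun wedge_free_const[abs_def])
    have "(\<Sum>j\<in>UNIV. wedge_free q (\<lambda>(a, b). d_free q a (if j = i then 1 else 0) * (if b
        = j then 1 else 0)) k
        + (if j = i then 1 else 0) * const (d_e_coeff q j k)) = const (d_e_coeff q i k)" for k
      by (cases i; cases k) (simp_all add: sum_idx)
    then have 2: "d1 q (e_basis q i) = inv_elem q (d_e_coeff q i)"
      unfolding e_basis_cls_fun d1_cls_fun[OF q] inv_elem_cls_fun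
      by (auto intro!: arg_cong[of _ _ "cls_fun q"])
    have "e_basis q i \<in> free_mod q" by (simp add: e_basis_cls_fun)
    then show "wedge_coeff q (nabla_matrix c i) = d_e_coeff q i"
      using * 1 2 by (simp add: torsion_free_def)
  qed
qed

lemma torsion_compatible_sigma_iff:
  "torsion_compatible q (sigma q c) \<longleftrightarrow>
     (\<forall>i j. wedge_coeff q (\<lambda>p. (if p = (i, j) then 1 else 0) + sigma_matrix q c i j p) = (\<lambda>_. 0))"
proof
  assume *: "\<forall>i j. wedge_coeff q (\<lambda>p. (if p = (i, j) then 1 else 0) + sigma_matrix q c i j p)
      = (\<lambda>_. 0)"
  have "wedge_free q (\<lambda>p. t p + matrix_map_free (sigma_matrix q c) t p) k = 0" for t k
  proof -
    have "(\<lambda>p. t p + matrix_map_free (sigma_matrix q c) t p)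
        = (\<lambda>p. \<Sum>i\<in>UNIV. \<Sum>j\<in>UNIV. t (i, j) * const ((if p = (i, j) then 1 else 0)
            + sigma_matrix q c i j p))"
    proof
      fix p :: "idx \<times> idx"
      have "t p = (\<Sum>i\<in>UNIV. \<Sum>j\<in>UNIV. t (i, j) * const (if p = (i, j) then 1 else 0))"
        by (cases p; cases "fst p"; cases "snd p") (simp_all add: sum_idx)
      then show "t p + matrix_map_free (sigma_matrix q c) t p
        = (\<Sum>i\<in>UNIV. \<Sum>j\<in>UNIV. t (i, j) * const ((if p = (i, j) then 1 else 0)
            + sigma_matrix q c i j p))"
        by (simp add: matrix_map_free_def const_add distrib_left sum.distrib)
    qed
    then show ?thesis
      by (simp only: wedge_free_sum wedge_free_mult_const * ) simp
  qed
  then show "torsion_compatible q (sigma q c)"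
    unfolding torsion_compatible_def ball_free_mod matrix_map_cls_fun plus_mod_cls_fun wedge_cls_fun
      zero_mod_def inv_elem_cls_fun
    by (auto intro: arg_cong[of _ _ "cls_fun q"])
next
  assume *: "torsion_compatible q (sigma q c)"
  show "\<forall>i j. wedge_coeff q (\<lambda>p. (if p = (i, j) then 1 else 0) + sigma_matrix q c i j p) = (\<lambda>_. 0)"
  proof (intro allI)
    fix i j
    have e: "tens q (e_basis q i) (e_basis q j) = inv_elem q (\<lambda>p. if p = (i, j) then 1 else 0)"
      unfolding e_basis_cls_fun tens_cls_fun[OF q] inv_elem_cls_fun
      by (rule arg_cong[of _ _ "cls_fun q"]) auto
    have "wedge q (plus_mod q (tens q (e_basis q i) (e_basis q j)) (sigma q c (tens q (e_basis q
        i) (e_basis q j))))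
        = inv_elem q (wedge_coeff q (\<lambda>p. (if p = (i, j) then 1 else 0) + sigma_matrix q c i j p))"
      unfolding sigma_basis[OF q] unfolding e inv_elem_cls_fun plus_mod_cls_fun wedge_cls_fun
          const_add[symmetric]
        wedge_free_const[abs_def] ..
    moreover have "tens q (e_basis q i) (e_basis q j) \<in> free_mod q"
      unfolding e inv_elem_cls_fun by simp
    ultimately show "wedge_coeff q (\<lambda>p. (if p = (i, j) then 1 else 0) + sigma_matrix q c i j p)
        = (\<lambda>_. 0)"
      using * by (simp add: torsion_compatible_def zero_mod_def)
  qed
qed

section \<open>Preservation of the metric\<close>

text \<open>The Christoffel forms have constant coefficients, the star sends index
  \<open>bar l\<close> to \<open>l\<close>, and a diagonal metric leaves one term of each
  sum.\<close>

lemma preserves_metric_nabla_iff: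
  "preserves_metric q g (nabla q c) \<longleftrightarrow> (\<forall>i k l.
     of_real (g k * star_coeff q (bar l)) * cnj (nabla_matrix c k (bar l, i))
       + of_real (g i) * nabla_matrix c i (l, k) = 0)"
proof -
  have chr: "christoffel q (nabla q c) i k = inv_elem q (\<lambda>j. - nabla_matrix c i (j, k))" for i k
    using nabla_has_coeffs[OF q, of c]
    by (simp add: christoffel_def has_coeffs_def inv_elem_def scalar_def const_uminus)
  have "(\<lambda>l. \<Oplus>\<^bsub>SU q\<^esub>j\<in>UNIV.
         smult q (metric_matrix g j k) (star1 q (christoffel q (nabla q c) j i)) l \<oplus>\<^bsub>SU q\<^esub>
         smult q (metric_matrix g i j) (christoffel q (nabla q c) j k) l)
     = inv_elem q (\<lambda>l. \<Sum>j\<in>UNIV. metric_matrix g j k * (of_real (star_coeff q (bar l)) *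
         - cnj (nabla_matrix c j (bar l, i)))
          + metric_matrix g i j * - nabla_matrix c j (l, k))" for i k
    unfolding chr inv_elem_cls_fun star1_cls_fun[OF q] smult_cls_fun
    by (simp add: cls_fun_def const_mult[symmetric] const_add[symmetric] additive_sum[of const,
        OF const_add, symmetric])
  also have "\<dots> i k = inv_elem q (\<lambda>l. - (of_real (g k * star_coeff q (bar l)) * cnj (nabla_matrix c
      k (bar l, i))
       + of_real (g i) * nabla_matrix c i (l, k)))" for i k
    by (cases i; cases k) (simp_all add: sum_idx metric_matrix_def algebra_simps del:
        nabla_matrix.simps)
  finally have "preserves_metric q g (nabla q c) \<longleftrightarrow> (\<forall>i k.
     (\<lambda>l. - (of_real (g k * star_coeff q (bar l)) * cnj (nabla_matrix c k (bar l, i))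
       + of_real (g i) * nabla_matrix c i (l, k))) = (\<lambda>_. 0))"
    unfolding preserves_metric_def zero_mod_def by simp
  then show ?thesis by (simp only: fun_eq_iff neg_equal_0_iff_equal)
qed


section \<open>Star compatibility of the braiding\<close>

lemma matrix_map_inv_elem: "matrix_map q S (inv_elem q z) = inv_elem q (matrix_coeff S z)"
  unfolding inv_elem_cls_fun matrix_map_cls_fun
  by (rule arg_cong[of _ _ "cls_fun q"])
    (simp add: matrix_map_free_def matrix_coeff_def fun_eq_iff const_mult additive_sum[of const,
        OF const_add])

lemma tau_inv_elem:
  "tau q (inv_elem q z) = inv_elem q (\<lambda>(k, l). of_real (star_coeff q (bar k) * star_coeff q (bar
      l)) * cnj (z (bar l, bar k)))"
  unfolding inv_elem_cls_fun tau_cls_fun[OF q]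
  by (rule arg_cong[of _ _ "cls_fun q"]) (simp add: fun_eq_iff const_mult)

lemma matrix_coeff_sigma:
  "matrix_coeff (sigma_matrix q c) z (Zero, Zero) = sigma_R q c * z (Zero, Zero)"
  "matrix_coeff (sigma_matrix q c) z (Plus, Zero) = of_real (q ^ 4) * z (Zero, Plus)
      + sigma_M_plus q c * z (Plus, Zero)"
  "matrix_coeff (sigma_matrix q c) z (Zero, Plus) = sigma_N_plus q c * z (Plus, Zero)"
  "matrix_coeff (sigma_matrix q c) z (Minus, Zero)
    = of_real (q powi (-4)) * z (Zero, Minus) + sigma_M_minus q c * z (Minus, Zero)"
  "matrix_coeff (sigma_matrix q c) z (Zero, Minus) = sigma_N_minus q c * z (Minus, Zero)"
  by (simp_all add: matrix_coeff_def sum_idx sigma_entries)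

lemma matrix_map_free_sigma:
  "matrix_map_free (sigma_matrix q c) t (Zero, Zero) = const (sigma_R q c) * t (Zero, Zero)"
  "matrix_map_free (sigma_matrix q c) t (Plus, Zero)
    = const (of_real (q ^ 4)) * t (Zero, Plus) + const (sigma_M_plus q c) * t (Plus, Zero)"
  "matrix_map_free (sigma_matrix q c) t (Zero, Plus) = const (sigma_N_plus q c) * t (Plus, Zero)"
  "matrix_map_free (sigma_matrix q c) t (Minus, Zero)
    = const (of_real (q powi (-4))) * t (Zero, Minus) + const (sigma_M_minus q c) * t (Minus, Zero)"
  "matrix_map_free (sigma_matrix q c) t (Zero, Minus) = const (sigma_N_minus q c) * t (Minus, Zero)"
  "matrix_map_free (sigma_matrix q c) t (Plus, Plus) = const (of_real (q ^ 2)) * t (Plus, Plus)"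
  "matrix_map_free (sigma_matrix q c) t (Plus, Minus) = const (of_real (q ^ 2)) * t (Minus, Plus)"
  "matrix_map_free (sigma_matrix q c) t (Minus, Plus) = const (of_real (q powi (-2))) * t (Plus,
      Minus)"
  "matrix_map_free (sigma_matrix q c) t (Minus, Minus) = const (of_real (q powi (-2))) * t (Minus,
      Minus)"
  by (simp_all add: matrix_map_free_def sum_idx sigma_entries const_central[of "t _"])

lemma matrix_map_free_sigma_inverse:
  "matrix_map_free (sigma_inverse_matrix q c) t (Zero, Zero) = const (1 / sigma_R q c) * t (Zero,
      Zero)"
  "matrix_map_free (sigma_inverse_matrix q c) t (Zero, Plus)
      = const (of_real (q powi (-4))) * t (Plus, Zero)
     + const (- (sigma_M_plus q c * of_real (q powi (-4))) / sigma_N_plus q c) * t (Zero, Plus)"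
  "matrix_map_free (sigma_inverse_matrix q c) t (Plus, Zero)
      = const (1 / sigma_N_plus q c) * t (Zero, Plus)"
  "matrix_map_free (sigma_inverse_matrix q c) t (Zero, Minus)
      = const (of_real (q ^ 4)) * t (Minus, Zero)
     + const (- (sigma_M_minus q c * of_real (q ^ 4)) / sigma_N_minus q c) * t (Zero, Minus)"
  "matrix_map_free (sigma_inverse_matrix q c) t (Minus, Zero)
      = const (1 / sigma_N_minus q c) * t (Zero, Minus)"
  "matrix_map_free (sigma_inverse_matrix q c) t (Plus, Plus)
      = const (of_real (q powi (-2))) * t (Plus, Plus)"
  "matrix_map_free (sigma_inverse_matrix q c) t (Minus, Plus)
      = const (of_real (q powi (-2))) * t (Plus, Minus)"
  "matrix_map_free (sigma_inverse_matrix q c) t (Plus, Minus)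
      = const (of_real (q ^ 2)) * t (Minus, Plus)"
  "matrix_map_free (sigma_inverse_matrix q c) t (Minus, Minus)
      = const (of_real (q ^ 2)) * t (Minus, Minus)"
  by (simp_all add: matrix_map_free_def sum_idx const_central[of "t _"])

lemma sigma_bij_betw:
  assumes "sigma_R q c \<noteq> 0" "sigma_N_plus q c \<noteq> 0" "sigma_N_minus q c \<noteq> 0"
  shows "bij_betw (sigma q c) (free_mod q) (free_mod q)"
proof (rule bij_betw_byWitness[where f' = "matrix_map q (sigma_inverse_matrix q c)"])
  have qpow: "of_real q ^ n * of_real q powi (- int n) = (1 :: complex)"
    "of_real q powi (- int n) * of_real q ^ n = (1 :: complex)" for n
    using q by (simp_all add: power_int_minus)
  note qs = qpow[of 2, simplified] qpow[of 4, simplified]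
  have "matrix_map_free (sigma_inverse_matrix q c) (matrix_map_free (sigma_matrix q c) t) = t" for t
    unfolding fun_eq_iff all_idx_pair all_idx using assms qs
    by (simp add: matrix_map_free_sigma matrix_map_free_sigma_inverse const_const_mult distrib_left
        const_add[symmetric] distrib_right[symmetric] const_uminus mult.commute)
  then show "\<forall>t\<in>free_mod q. matrix_map q (sigma_inverse_matrix q c) (sigma q c t) = t"
    by (simp add: ball_free_mod matrix_map_cls_fun)
  have "matrix_map_free (sigma_matrix q c) (matrix_map_free (sigma_inverse_matrix q c) t) = t" for t
    unfolding fun_eq_iff all_idx_pair all_idx using assms q
    by (simp add: matrix_map_free_sigma matrix_map_free_sigma_inverse const_const_mult distrib_left
        right_diff_distrib const_uminus power_int_minus) (simp add: field_simps)
  then show "\<forall>t\<in>free_mod q. sigma q c (matrix_map q (sigma_inverse_matrix q c) t) = t"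
    by (simp add: ball_free_mod matrix_map_cls_fun)
qed (auto simp: free_mod_eq matrix_map_cls_fun)

text \<open>The condition is imposed entry by entry. The entries not involving e^0 cancel as powers
  of \<open>q\<close>, and the listed equations come from e^0 tensor e^0 and from the blocks pairing
  e^+ or e^- with e^0.\<close>

lemma star_compatible_sigma_iff:
  "star_compatible q (sigma q c) \<longleftrightarrow>
     sigma_R q c * cnj (sigma_R q c) = 1 \<and> sigma_N_minus q c * cnj (sigma_N_plus q c) = 1 \<and>
     cnj (sigma_N_plus q c) * sigma_M_minus q c + cnj (sigma_M_plus q c) * of_real (q powi (-4))
         = 0 \<and>
     cnj (sigma_N_minus q c) * sigma_M_plus q c + cnj (sigma_M_minus q c) * of_real (q ^ 4) = 0"
    (is "_ \<longleftrightarrow> ?R")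
proof
  assume *: "star_compatible q (sigma q c)"
  have 1: "inv_elem q z \<in> free_mod q" for z :: "idx \<times> idx \<Rightarrow> complex"
    by (simp add: inv_elem_cls_fun)
  let ?S = "matrix_coeff (sigma_matrix q c)"
  let ?T = "\<lambda>z. \<lambda>(k, l). of_real (star_coeff q (bar k) * star_coeff q (bar l)) * cnj (z (bar l,
      bar k))"
  have "?S (?T (?S z)) = ?T z" for z
  proof -
    have "sigma q c (tau q (sigma q c (inv_elem q z))) = tau q (inv_elem q z)"
      using * 1 by (simp add: star_compatible_def)
    then show ?thesis unfolding matrix_map_inv_elem tau_inv_elem inv_elem_inject .
  qed
  then have "?S (?T (?S z)) p = ?T z p" for z p by metis
  \<comment> \<open>Four matrix entries, one for each of the four equations; the next fact cancels
    the nonzero star factor that they share.\<close>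
  from this[of "\<lambda>p. if p = (Zero, Zero) then 1 else 0" "(Zero, Zero)"]
    this[of "\<lambda>p. if p = (Plus, Zero) then 1 else 0" "(Zero, Minus)"]
    this[of "\<lambda>p. if p = (Plus, Zero) then 1 else 0" "(Minus, Zero)"]
    this[of "\<lambda>p. if p = (Minus, Zero) then 1 else 0" "(Plus, Zero)"]
  moreover have "x * (u * y) + z * (u * w) = 0 \<longleftrightarrow> w * z + y * x
      = 0" if "u \<noteq> 0" for u x y z w :: complex
  proof -
    have "x * (u * y) + z * (u * w) = u * (w * z + y * x)" by (simp add: algebra_simps)
    then show ?thesis using that by simp
  qed
  ultimately show ?R using q
    by (simp add: matrix_coeff_sigma power_int_minus)
next
  assume R: ?R
  then have bij: "bij_betw (sigma q c) (free_mod q) (free_mod q)"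
    by (intro sigma_bij_betw) auto
  \<comment> \<open>The two products are complex conjugates of each other, so a single equation
    yields both cancellations.\<close>
  have NN: "sigma_N_plus q c * (u * cnj (sigma_N_minus q c)) = u"
    "sigma_N_minus q c * (u * cnj (sigma_N_plus q c)) = u" for u
  proof -
    have "sigma_N_minus q c * cnj (sigma_N_plus q c) = 1" using R by blast
    moreover from this have "sigma_N_plus q c * cnj (sigma_N_minus q c) = 1"
      by (metis complex_cnj_cnj complex_cnj_mult complex_cnj_one mult.commute)
    ultimately show "sigma_N_plus q c * (u * cnj (sigma_N_minus q c)) = u"
      "sigma_N_minus q c * (u * cnj (sigma_N_plus q c)) = u" by (simp_all add: mult.left_commute)
  qed
  have M_plus: "const (of_real q ^ 4 * (u * cnj (sigma_M_minus q c))) * y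
      + const (sigma_M_plus q c * (u * cnj (sigma_N_minus q c))) * y = 0" for u y
  proof -
    have "of_real q ^ 4 * (u * cnj (sigma_M_minus q c)) + sigma_M_plus q c * (u * cnj
        (sigma_N_minus q c))
      = u * (cnj (sigma_N_minus q c) * sigma_M_plus q c + cnj (sigma_M_minus q c) * of_real (q ^
          4))"
      by (simp add: algebra_simps)
    then show ?thesis using R by (simp add: distrib_right[symmetric] const_add[symmetric])
  qed
  have M_minus: "const (of_real q powi (-4) * (u * cnj (sigma_M_plus q c))) * y
      + const (sigma_M_minus q c * (u * cnj (sigma_N_plus q c))) * y = 0" for u y
  proof -
    have "of_real q powi (-4) * (u * cnj (sigma_M_plus q c))
        + sigma_M_minus q c * (u * cnj (sigma_N_plus q c))
      = u * (cnj (sigma_N_plus q c) * sigma_M_minus q c + cnj (sigma_M_plus q c) * of_real (q powi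
          (-4)))"
      by (simp add: algebra_simps)
    then show ?thesis using R by (simp add: distrib_right[symmetric] const_add[symmetric])
  qed
  have powers: "of_real q ^ 2 * (u * of_real q powi (-2)) = (u :: complex)"
    "of_real q powi (-2) * (u * of_real q ^ 2) = (u :: complex)"
    "of_real q ^ 4 * (u * of_real q powi (-4)) = (u :: complex)"
    "of_real q powi (-4) * (u * of_real q ^ 4) = (u :: complex)"
    "of_real q ^ 2 * of_real q powi (-2) = (1 :: complex)"
    "of_real q powi (-2) * of_real q ^ 2 = (1 :: complex)" for u
    using q by (simp_all add: power_int_minus)
  have twist: "twist_free q Zero (twist_free q Plus x) = twist_free q Plus (twist_free q Zero x)"
    "twist_free q Zero (twist_free q Minus x) = twist_free q Minus (twist_free q Zero x)"
    "twist_free q Minus (twist_free q Plus x) = twist_free q Plus (twist_free q Minus x)" for x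
    by (rule twist_free_twist_free[OF q]; simp)+
  let ?\<tau> = "\<lambda>t. \<lambda>(k, l). const (of_real (star_coeff q (bar k) * star_coeff q (bar l))) *
     twist_free q k (twist_free q l (star_free q (t (bar l, bar k))))"
  have "matrix_map_free (sigma_matrix q c) (?\<tau> (matrix_map_free (sigma_matrix q c) t)) (k, l)
      = ?\<tau> t (k, l)" for t k l
    using q R by (cases k; cases l)
     (simp_all add: matrix_map_free_sigma star_free_add star_free_mult twist_free_add
         twist_free_mult[OF q]
        const_central[of "twist_free _ _ _"] const_const_mult const_mult[symmetric] distrib_left
            add.assoc
        twist powers NN M_plus M_minus)
  then have "matrix_map_free (sigma_matrix q c) (?\<tau> (matrix_map_free (sigma_matrix q c) t))
      = ?\<tau> t" for t
    unfolding fun_eq_iff all_idx_pair by blast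
  then show "star_compatible q (sigma q c)"
    unfolding star_compatible_def ball_free_mod matrix_map_cls_fun tau_cls_fun[OF q] using bij by
        simp
qed

end


section \<open>The classical limit\<close>

context
  fixes q :: real
  assumes q: "q \<noteq> 0"
begin

text \<open>The equation for e^- is multiplied by q^4 to clear its negative powers.\<close>

lemma torsion_free_nabla_eqs:
  "torsion_free q (nabla q c) \<longleftrightarrow>
     c Coeff_nu - of_real (q ^ 2) * c Coeff_mu = of_real (q ^ 3) \<and>
     c Coeff_m_plus - of_real (q ^ 4) * c Coeff_n_plus = - of_real (q ^ 2 + 1) \<and>
     of_real (q ^ 4) * c Coeff_m_minus - c Coeff_n_minus = of_real (q ^ 2 + 1)"
  unfolding torsion_free_nabla_iff[OF q] all_idx fun_eq_iff all_idx2
  using q by (auto simp: power_int_minus field_simps eval_nat_numeral)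

text \<open>The zero torsion is a bimodule map. In coordinates, eliminating m_+ and n_- by the
  torsion equations makes the relevant entries of the braiding cancel.\<close>

lemma torsion_free_imp_torsion_compatible:
  assumes "torsion_free q (nabla q c)"
  shows "torsion_compatible q (sigma q c)"
proof -
  have mp: "c Coeff_m_plus = of_real (q ^ 4) * c Coeff_n_plus - of_real (q ^ 2 + 1)"
    using assms by (simp add: torsion_free_nabla_eqs algebra_simps)
  have nm: "c Coeff_n_minus = of_real (q ^ 4) * c Coeff_m_minus - of_real (q ^ 2 + 1)"
    using assms unfolding torsion_free_nabla_eqs by (metis diff_diff_eq2 add_diff_cancel_left')
  show ?thesis
    unfolding torsion_compatible_sigma_iff[OF q] all_idx fun_eq_iff all_idx2
    using q by (simp add: mp nm power_int_minus) (simp add: field_simps eval_nat_numeral)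
qed

text \<open>The condition pairs the entry (l, k) of \<nabla>e^i with the entry
  (\<open>bar l\<close>, i) of \<nabla>e^k. The coefficients r, n_+ and n_- are paired with
  themselves and become real; \<mu> is paired with m_+ and \<nu> with m_-.\<close>

lemma preserves_metric_nabla_eqs:
  assumes g: "\<And>i. g i > 0"
  shows "preserves_metric q g (nabla q c) \<longleftrightarrow>
     cnj (c Coeff_r) = c Coeff_r \<and> cnj (c Coeff_n_plus) = c Coeff_n_plus \<and>
     cnj (c Coeff_n_minus) = c Coeff_n_minus \<and>
     c Coeff_mu = of_real (g Plus / (q * g Zero)) * cnj (c Coeff_m_plus) \<and>
     c Coeff_nu = of_real (q * g Minus / g Zero) * cnj (c Coeff_m_minus)"
proof -
  have g': "g i \<noteq> 0" for i using g[of i] by simp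
  show ?thesis (is "_ \<longleftrightarrow> ?R")
    unfolding preserves_metric_nabla_iff[OF q]
  proof
    assume ?R
    then have R: "cnj (c Coeff_r) = c Coeff_r" "cnj (c Coeff_n_plus) = c Coeff_n_plus"
      "cnj (c Coeff_n_minus) = c Coeff_n_minus"
      "c Coeff_mu = of_real (g Plus / (q * g Zero)) * cnj (c Coeff_m_plus)"
      "c Coeff_nu = of_real (q * g Minus / g Zero) * cnj (c Coeff_m_minus)" by simp_all
    show "\<forall>i k l. of_real (g k * star_coeff q (bar l)) * cnj (nabla_matrix c k (bar l, i))
       + of_real (g i) * nabla_matrix c i (l, k) = 0"
      unfolding all_idx using q g' by (simp add: R power_int_minus) (simp add: field_simps)
  next
    assume L: "\<forall>i k l. of_real (g k * star_coeff q (bar l)) * cnj (nabla_matrix c k (bar l, i))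
       + of_real (g i) * nabla_matrix c i (l, k) = 0"
    show ?R
    proof (intro conjI)
      \<comment> \<open>The instances of \<open>L\<close> below list the indices in the order
        \<open>k\<close>, \<open>l\<close>, \<open>i\<close>.\<close>
      show "cnj (c Coeff_r) = c Coeff_r"
        using L[rule_format, of Zero Zero Zero] g' by (simp add: algebra_simps)
      show "cnj (c Coeff_n_plus) = c Coeff_n_plus"
        using L[rule_format, of Plus Zero Plus] g' by (simp add: algebra_simps)
      show "cnj (c Coeff_n_minus) = c Coeff_n_minus"
        using L[rule_format, of Minus Zero Minus] g' by (simp add: algebra_simps)
      show "c Coeff_mu = of_real (g Plus / (q * g Zero)) * cnj (c Coeff_m_plus)"
        using L[rule_format, of Plus Minus Zero] q g' by (simp add: power_int_minus field_simps)
      show "c Coeff_nu = of_real (q * g Minus / g Zero) * cnj (c Coeff_m_minus)"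
        using L[rule_format, of Minus Plus Zero] q g' by (simp add: field_simps)
    qed
  qed
qed

end

section \<open>The reality condition at q = 1 and the Levi-Civita connection\<close>

text \<open>At q = 1 all twists are trivial and all star factors are -1. The basis forms give the
  coefficient condition; conversely the differentials match by \<open>d_free_1_star\<close> and the
  constants by assumption.\<close>

lemma star_levi_civita_iff:
  "(\<forall>\<xi>\<in>free_mod 1. nabla 1 c (star1 1 \<xi>) = star_tens 1 (nabla 1 c \<xi>)) \<longleftrightarrow>
     (\<forall>k i j. nabla_matrix c (bar k) (i, j) = - cnj (nabla_matrix c k (bar i, bar j)))"
    (is "?L \<longleftrightarrow> ?R")
proof
  have 1: "(1::real) \<noteq> 0" by simp
  have coeff: "star_coeff 1 i = - 1" for i by (cases i) simp_all
  assume ?L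
  show ?R
  proof (intro allI)
    fix k i j
    have "star1 1 (e_basis 1 k) = inv_elem 1 (\<lambda>l. if l = bar k then - 1 else 0)"
      unfolding e_basis_cls_fun star1_cls_fun[OF 1] inv_elem_cls_fun
      by (rule arg_cong[of _ _ "cls_fun 1"]) (auto simp: coeff bar_eq_iff const_uminus)
    moreover have "nabla 1 c (inv_elem 1 (\<lambda>l. if l = bar k then - 1 else 0))
        = inv_elem 1 (\<lambda>p. - nabla_matrix c (bar k) p)"
      unfolding inv_elem_cls_fun nabla_cls_fun[OF 1]
      by (rule arg_cong[of _ _ "cls_fun 1"], rule ext, cases k)
        (auto simp: nabla_free_def sum_idx const_uminus simp del: nabla_matrix.simps)
    moreover have "star_tens 1 (inv_elem 1 (nabla_matrix c k))
        = inv_elem 1 (\<lambda>(i, j). cnj (nabla_matrix c k (bar i, bar j)))"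
      unfolding inv_elem_cls_fun star_tens_cls_fun[OF 1]
      by (rule arg_cong[of _ _ "cls_fun 1"]) (auto simp: coeff)
    moreover have "nabla 1 c (star1 1 (e_basis 1 k)) = star_tens 1 (nabla 1 c (e_basis 1 k))"
      using \<open>?L\<close> by (simp add: e_basis_cls_fun)
    ultimately have "(\<lambda>p. - nabla_matrix c (bar k) p) = (\<lambda>(i, j). cnj (nabla_matrix c k (bar i,
        bar j)))"
      using nabla_has_coeffs[OF 1, of c] by (simp add: has_coeffs_def)
    from fun_cong[OF this, of "(i, j)"]
    have "- nabla_matrix c (bar k) (i, j) = cnj (nabla_matrix c k (bar i, bar j))" by simp
    then show "nabla_matrix c (bar k) (i, j) = - cnj (nabla_matrix c k (bar i, bar j))"
      by (metis minus_minus)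
  qed
next
  have 1: "(1::real) \<noteq> 0" by simp
  have coeff: "star_coeff 1 i = - 1" for i by (cases i) simp_all
  assume R: ?R
  have "nabla_free 1 c (\<lambda>k. - star_free 1 (x (bar k))) (i, j)
      = star_free 1 (nabla_free 1 c x (bar i, bar j))" for x i j
  proof -
    have "(\<Sum>k\<in>UNIV. - star_free 1 (x (bar k)) * const (nabla_matrix c k (i, j)))
        = (\<Sum>k\<in>UNIV. star_free 1 (x k) * const (cnj (nabla_matrix c k (bar i, bar j))))"
      using R[rule_format, of Plus i j] R[rule_format, of Zero i j] R[rule_format, of Minus i j]
      by (simp add: sum_idx const_uminus del: nabla_matrix.simps)
    then show ?thesis
      by (simp add: nabla_free_def d_free_uminus d_free_1_star star_free_add star_free_sum
          star_free_mult
        const_central)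
  qed
  then show ?L
    unfolding ball_free_mod star1_cls_fun[OF 1] nabla_cls_fun[OF 1] star_tens_cls_fun[OF 1]
    by (auto simp: coeff const_uminus intro!: arg_cong[of _ _ "cls_fun 1"])
qed

lemma levi_civita_iff:
  "levi_civita g D \<longleftrightarrow> (\<exists>c. D = nabla 1 c \<and> torsion_free 1 (nabla 1 c)
      \<and> preserves_metric 1 g (nabla 1 c) \<and>
     (\<forall>k i j. nabla_matrix c (bar k) (i, j) = - cnj (nabla_matrix c k (bar i, bar j))))"
  unfolding levi_civita_def star_levi_civita_iff[symmetric]
  using nabla_unique[of 1] nabla_covariant_derivative[of 1] nabla_has_coeffs[of 1]
  by (metis zero_neq_one)

text \<open>The values of \<open>solution\<close> for r = 0 as x tends to 1 and m_+ tends to - g_00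
  / (g_++ + g_--). If g_++ = g_-- they are the classical Levi-Civita coefficients.\<close>

fun limit_coeff :: "(idx \<Rightarrow> real) \<Rightarrow> coeff \<Rightarrow> real" where
  "limit_coeff g Coeff_r = 0"
| "limit_coeff g Coeff_nu = g Minus / (g Plus + g Minus)"
| "limit_coeff g Coeff_mu = - g Plus / (g Plus + g Minus)"
| "limit_coeff g Coeff_n_plus = 2 - g Zero / (g Plus + g Minus)"
| "limit_coeff g Coeff_n_minus = g Zero / (g Plus + g Minus) - 2"
| "limit_coeff g Coeff_m_plus = - g Zero / (g Plus + g Minus)"
| "limit_coeff g Coeff_m_minus = g Zero / (g Plus + g Minus)"

text \<open>Metric and reality conditions make r both real and imaginary, and m_- = - m_+ with m_+
  real by torsion. The torsion equation \<nu> - \<mu> = 1 then fixes m_+, and everything else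
  follows from it.\<close>

lemma levi_civita_eq:
  assumes g: "\<And>i. g i > 0" and "g Plus = g Minus"
  shows "{D. levi_civita g D} = {nabla 1 (\<lambda>k. of_real (limit_coeff g k))}"
proof -
  have 1: "(1::real) \<noteq> 0" by simp
  have g': "g i \<noteq> 0" for i using g[of i] by simp
  have "torsion_free 1 (nabla 1 c) \<and> preserves_metric 1 g (nabla 1 c) \<and>
     (\<forall>k i j. nabla_matrix c (bar k) (i, j) = - cnj (nabla_matrix c k (bar i, bar j)))
     \<longleftrightarrow> c = (\<lambda>k. of_real (limit_coeff g k))" (is "?L c \<longleftrightarrow> ?R c") for c
  proof
    assume L: "?L c"
    note tf = L[THEN conjunct1, unfolded torsion_free_nabla_eqs[OF 1]]
    note pm = L[THEN conjunct2, THEN conjunct1, unfolded preserves_metric_nabla_eqs[of 1 g, OF 1 g]]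
    have star: "nabla_matrix c (bar k) (i, j) = - cnj (nabla_matrix c k (bar i, bar j))" for k i j
      using L by blast
    have r: "c Coeff_r = 0" using star[of Zero Zero Zero] pm by (simp add: eq_neg_iff_add_eq_0)
    have mp: "cnj (c Coeff_m_plus) = c Coeff_m_plus"
    proof -
      have "c Coeff_m_plus = c Coeff_n_plus - 2" using tf by (simp add: algebra_simps)
      then show ?thesis using pm by simp
    qed
    have mm: "c Coeff_m_minus = - c Coeff_m_plus"
      using star[of Plus Minus Zero] mp by simp
    have mu: "c Coeff_mu = of_real (g Plus / g Zero) * c Coeff_m_plus"
      using pm mp by simp
    have nu: "c Coeff_nu = - of_real (g Plus / g Zero) * c Coeff_m_plus"
      using pm mp mm assms(2) by simp
    have "- (2 * of_real (g Plus / g Zero) * c Coeff_m_plus) = 1"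
      using tf mu nu by (simp add: algebra_simps)
    then have "2 * of_real (g Plus / g Zero) * c Coeff_m_plus = - 1"
      by (metis minus_minus)
    then have mp': "c Coeff_m_plus = of_real (- g Zero / (g Plus + g Minus))"
      using g' assms(2) by (simp add: field_simps)
    have np: "c Coeff_n_plus = c Coeff_m_plus + 2" and nm: "c Coeff_n_minus = c Coeff_m_minus - 2"
      using tf by (simp_all add: algebra_simps)
    have "c k = of_real (limit_coeff g k)" for k
      using g' assms(2) by (cases k) (simp_all add: r nu mu np nm mm mp')
    then show "?R c" by auto
  next
    assume c: "?R c"
    show "?L c"
      unfolding torsion_free_nabla_eqs[OF 1] preserves_metric_nabla_eqs[of 1 g, OF 1 g] all_idx
      using g' assms(2) by (simp add: c field_simps)
  qed
  then show ?thesis unfolding levi_civita_iff by auto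
qed


section \<open>Solving for the coefficients\<close>

definition metric_root :: "real \<Rightarrow> (idx \<Rightarrow> real) \<Rightarrow> real \<Rightarrow> bool" where
  "metric_root q g x \<longleftrightarrow>
     g Plus * x ^ 2 - (g Plus - g Minus - q ^ 2 * (1 - q ^ 2) * g Zero) * x - g Minus = 0"

text \<open>With m_+ = (x - 1) / s and s = 1 - q^2, the value of m_- comes from 1 + s m_- = 1/x,
  those of n_+ and n_- from the torsion equations, and those of \<nu> and \<mu> from the
  metric.\<close>

fun solution :: "real \<Rightarrow> (idx \<Rightarrow> real) \<Rightarrow> real \<Rightarrow> real \<Rightarrow> coeff \<Rightarrow> real" where
  "solution q g r x Coeff_r = r"
| "solution q g r x Coeff_m_plus = (x - 1) / (1 - q ^ 2)"
| "solution q g r x Coeff_m_minus = - ((x - 1) / (1 - q ^ 2)) / x"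
| "solution q g r x Coeff_n_plus = ((x - 1) / (1 - q ^ 2) + q ^ 2 + 1) / q ^ 4"
| "solution q g r x Coeff_n_minus = q ^ 4 * (- ((x - 1) / (1 - q ^ 2)) / x) - (q ^ 2 + 1)"
| "solution q g r x Coeff_nu = q * g Minus / g Zero * (- ((x - 1) / (1 - q ^ 2)) / x)"
| "solution q g r x Coeff_mu = g Plus / (q * g Zero) * ((x - 1) / (1 - q ^ 2))"

abbreviation solution_nabla :: "real \<Rightarrow> (idx \<Rightarrow> real) \<Rightarrow> real \<Rightarrow> real \<Rightarrow> form1 \<Rightarrow> form11" where
  "solution_nabla q g r x \<equiv> nabla q (\<lambda>k. of_real (solution q g r x k))"

text \<open>Uniqueness of the coefficients identifies the braiding in the existential with
  \<open>sigma q c\<close>; vanishing torsion supplies torsion compatibility.\<close>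

lemma compatible_connections_nabla_iff:
  assumes "q \<noteq> 0"
  shows "nabla q c \<in> compatible_connections q g \<and> torsion_free q (nabla q c) \<longleftrightarrow>
    preserves_metric q g (nabla q c) \<and> torsion_free q (nabla q c) \<and> star_compatible q (sigma q c)"
  using invariant_bimodule_connection_iff[OF assms] torsion_free_imp_torsion_compatible[OF assms]
    has_coeffs_nabla_iff[OF assms]
  unfolding compatible_connections_def mem_Collect_eq by metis

lemma solution_nabla_inject:
  assumes q: "q \<noteq> 0" "q ^ 2 \<noteq> 1"
  shows "solution_nabla q g r x = solution_nabla q g r' x' \<longleftrightarrow> r = r' \<and> x = x'"
proof
  assume "solution_nabla q g r x = solution_nabla q g r' x'"
  then have "(\<lambda>k. complex_of_real (solution q g r x k)) = (\<lambda>k. of_real (solution q g r' x' k))"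
    using has_coeffs_nabla_iff[OF q(1)] nabla_has_coeffs[OF q(1)] by metis
  then have "complex_of_real (solution q g r x k) = of_real (solution q g r' x' k)" for k
    by (rule fun_cong)
  then have "solution q g r x k = solution q g r' x' k" for k
    unfolding of_real_eq_iff .
  from this[of Coeff_r] this[of Coeff_m_plus] q(2) show "r = r' \<and> x = x'"
    by (simp add: divide_cancel_right)
qed simp

context
  fixes q :: real and g :: "idx \<Rightarrow> real"
  assumes q: "q \<noteq> 0" "q ^ 2 \<noteq> 1" and g: "\<And>i. g i > 0"
begin

lemma metric_root_nonzero: "metric_root q g x \<Longrightarrow> x \<noteq> 0"
  using g[of Minus] by (auto simp: metric_root_def)

text \<open>Metric preservation and two torsion equations hold by construction. The third torsion
  equation is the quadratic for x, and star compatibility holds because the two N-entries are x /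
  q^4 and its inverse.\<close>

lemma solution_sound:
  assumes r: "r = 0 \<or> r = - 2 / (1 - q ^ 2)" and x: "metric_root q g x"
  shows "solution_nabla q g r x \<in> compatible_connections q g" "torsion_free q (solution_nabla q g
      r x)"
proof -
  define s where "s = 1 - q ^ 2"
  define m where "m = (x - 1) / s"
  define m' where "m' = - m / x"
  have s: "s \<noteq> 0" "q ^ 2 = 1 - s" using q by (auto simp: s_def)
  have x0: "x \<noteq> 0" by (rule metric_root_nonzero[OF x])
  have g': "g i \<noteq> 0" for i using g[of i] by simp
  have m: "x = 1 + s * m" using s by (simp add: m_def)
  have m': "m' * x = - m" using x0 by (simp add: m'_def)
  \<comment> \<open>Multiplied by s x, the remaining torsion equation becomes minus the quadratic;
    this factor is nonzero and can be cancelled.\<close>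
  have "s * ((g Minus * m' - g Plus * m) - q ^ 2 * g Zero) * x = 0"
  proof -
    have "s * ((g Minus * m' - g Plus * m) - q ^ 2 * g Zero) * x
        = g Minus * (s * (m' * x)) - g Plus * (s * m) * x - q ^ 2 * s * g Zero * x"
      by (simp add: algebra_simps)
    also have "\<dots> = g Minus * (1 - x) - g Plus * (x - 1) * x - q ^ 2 * s * g Zero * x"
      unfolding m' using m by simp
    also have "\<dots> = - (g Plus * x ^ 2 - (g Plus - g Minus - q ^ 2 * s * g Zero) * x - g Minus)"
      by (simp add: algebra_simps power2_eq_square)
    also have "\<dots> = 0" using x by (simp add: metric_root_def s_def)
    finally show ?thesis .
  qed
  then have quad: "g Minus * m' - g Plus * m = q ^ 2 * g Zero" using s x0 by simp
  define c where "c = (\<lambda>k. complex_of_real (solution q g r x k))"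
  have c: "c Coeff_r = of_real r" "c Coeff_m_plus = of_real m" "c Coeff_m_minus = of_real m'"
    "c Coeff_n_plus = of_real ((m + q ^ 2 + 1) / q ^ 4)" "c Coeff_n_minus = of_real (q ^ 4 * m'
        - (q ^ 2 + 1))"
    "c Coeff_nu = of_real (q * g Minus / g Zero * m')" "c Coeff_mu
        = of_real (g Plus / (q * g Zero) * m)"
    by (simp_all only: c_def solution.simps m'_def m_def s_def)
  have "q * g Minus / g Zero * m' - q ^ 2 * (g Plus / (q * g Zero) * m)
      = q / g Zero * (g Minus * m' - g Plus * m)"
    using q g' by (simp add: field_simps power2_eq_square)
  also have "\<dots> = q ^ 3"
    unfolding quad using g' by (simp add: power2_eq_square power3_eq_cube)
  finally have tf: "torsion_free q (nabla q c)"
    unfolding torsion_free_nabla_eqs[OF q(1)] c of_real_mult[symmetric] of_real_diff[symmetric]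
      of_real_minus[symmetric] of_real_eq_iff
    using q by simp
  have pm: "preserves_metric q g (nabla q c)"
    unfolding preserves_metric_nabla_eqs[of q g, OF q(1) g] c by simp
  have N: "sigma_N_plus q c = of_real (x / q ^ 4)" "sigma_N_minus q c = of_real (q ^ 4 / x)"
    "sigma_M_plus q c = of_real (x - 1)" "sigma_M_minus q c = of_real ((1 - x) / x)"
    "sigma_R q c = of_real (1 + r * s)"
  proof -
    have sc: "complex_of_real (1 - q ^ 2) = 1 - of_real q ^ 2" by simp
    have "1 + s * ((m + q ^ 2 + 1) / q ^ 4) = x / q ^ 4"
      using q by (simp add: m s_def field_simps power4_eq_xxxx power2_eq_square)
    then show "sigma_N_plus q c = of_real (x / q ^ 4)"
      unfolding sigma_N_plus_def c sc[symmetric] s_def[symmetric] by (metis of_real_1 of_real_add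
          of_real_mult)
    have x': "s * m' * x = 1 - x" using m' m by (simp add: mult.assoc)
    then have sm': "s * m' = (1 - x) / x" using x0 by (simp add: field_simps)
    have "1 + s * (q ^ 4 * m' - (q ^ 2 + 1)) = q ^ 4 * (1 + s * m')"
      by (simp add: s_def algebra_simps power4_eq_xxxx power2_eq_square)
    also have "\<dots> = q ^ 4 / x" unfolding sm' using x0 by (simp add: field_simps)
    finally show "sigma_N_minus q c = of_real (q ^ 4 / x)"
      unfolding sigma_N_minus_def c sc[symmetric] s_def[symmetric] by (metis of_real_1 of_real_add
          of_real_mult)
    show "sigma_M_plus q c = of_real (x - 1)"
      unfolding sigma_M_plus_def c sc[symmetric] s_def[symmetric] of_real_mult[symmetric] by (simp
          add: m)
    show "sigma_M_minus q c = of_real ((1 - x) / x)"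
      unfolding sigma_M_minus_def c sc[symmetric] s_def[symmetric] of_real_mult[symmetric] sm' ..
    show "sigma_R q c = of_real (1 + r * s)"
      by (simp add: sigma_R_def c s_def)
  qed
  \<comment> \<open>The two admissible values of r give 1 + r s = 1 and 1 + r s = -1.\<close>
  have "(1 + r * s) * (1 + r * s) = 1"
    using r s by (auto simp: s_def[symmetric])
  then have "star_compatible q (sigma q c)"
    unfolding star_compatible_sigma_iff[OF q(1)] N complex_cnj_complex_of_real
        of_real_mult[symmetric]
      of_real_add[symmetric] of_real_eq_1_iff of_real_eq_0_iff
    using q x0 by (simp add: power_int_minus field_simps)
  with tf pm compatible_connections_nabla_iff[OF q(1), of c g]
  show "solution_nabla q g r x \<in> compatible_connections q g" "torsion_free q (solution_nabla q g r
      x)"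
    by (auto simp: c_def)
qed

lemma solution_complete:
  assumes D: "D \<in> compatible_connections q g" "torsion_free q D"
  obtains r x where "r = 0 \<or> r = - 2 / (1 - q ^ 2)" "metric_root q g x" "D = solution_nabla q g r x"
proof -
  have g': "g i \<noteq> 0" for i using g[of i] by simp
  define s where "s = 1 - q ^ 2"
  have s: "s \<noteq> 0" using q by (auto simp: s_def)
  obtain c where c: "D = nabla q c"
    using D(1) invariant_bimodule_connection_iff[OF q(1)] by (auto simp: compatible_connections_def)
  have "preserves_metric q g (nabla q c) \<and> torsion_free q (nabla q c)
      \<and> star_compatible q (sigma q c)"
    using D compatible_connections_nabla_iff[OF q(1), of c g] by (simp add: c)
  then have pm: "preserves_metric q g (nabla q c)" and tf: "torsion_free q (nabla q c)"
    and st: "star_compatible q (sigma q c)" by blast+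
  note pm = pm[unfolded preserves_metric_nabla_eqs[of q g, OF q(1) g]]
  note tf = tf[unfolded torsion_free_nabla_eqs[OF q(1)]]
  note st = st[unfolded star_compatible_sigma_iff[OF q(1)]]
  \<comment> \<open>Metric preservation makes these three coefficients real; the torsion equations
    pass this on to m_+ and m_-, and the rest is real algebra.\<close>
  obtain r n n' where r: "c Coeff_r = of_real r" and n: "c Coeff_n_plus = of_real n"
    and n': "c Coeff_n_minus = of_real n'"
    using pm by (metis Reals_cases Reals_cnj_iff)
  define m where "m = q ^ 4 * n - (q ^ 2 + 1)"
  define m' where "m' = (n' + q ^ 2 + 1) / q ^ 4"
  have m: "c Coeff_m_plus = of_real m"
    using tf by (simp add: m_def n algebra_simps)
  have "of_real (q ^ 4) * c Coeff_m_minus = of_real (n' + q ^ 2 + 1)"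
    using tf by (simp add: n' algebra_simps)
  then have m': "c Coeff_m_minus = of_real m'"
    using q by (simp add: m'_def field_simps)
  have mu: "c Coeff_mu = of_real (g Plus / (q * g Zero) * m)" and nu: "c Coeff_nu
      = of_real (q * g Minus / g Zero * m')"
    using pm by (simp_all add: m m')
  have "complex_of_real (q * g Minus / g Zero * m' - q ^ 2 * (g Plus / (q * g Zero) * m))
      = of_real (q ^ 3)"
    using tf by (simp only: mu nu of_real_diff of_real_mult)
  then have "q * g Minus / g Zero * m' - q ^ 2 * (g Plus / (q * g Zero) * m) = q ^ 3"
    by (simp only: of_real_eq_iff)
  moreover have "q * g Minus / g Zero * m' - q ^ 2 * (g Plus / (q * g Zero) * m)
      = q / g Zero * (g Minus * m' - g Plus * m)"
    using q g' by (simp add: field_simps power2_eq_square)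
  ultimately have "q / g Zero * (g Minus * m' - g Plus * m) = q / g Zero * (q ^ 2 * g Zero)"
    using g' by (simp add: power2_eq_square power3_eq_cube)
  then have quad: "g Minus * m' - g Plus * m = q ^ 2 * g Zero"
    using q g' by (simp only: mult_cancel_left divide_eq_0_iff) simp
  have "sigma_R q c = of_real (1 + r * s)" "sigma_N_plus q c = of_real (1
      + s * n)" "sigma_N_minus q c = of_real (1 + s * n')"
    by (simp_all add: sigma_R_def sigma_N_plus_def sigma_N_minus_def r n n' s_def)
  then have "complex_of_real ((1 + r * s) * (1 + r * s)) = 1" "complex_of_real ((1 + s * n') * (1
      + s * n)) = 1"
    using st by (simp_all only: of_real_mult complex_cnj_complex_of_real)
  then have R: "(1 + r * s) * (1 + r * s) = 1" and N: "(1 + s * n') * (1 + s * n) = 1"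
    by (simp_all only: of_real_eq_1_iff)
  define x where "x = 1 + s * m"
  \<comment> \<open>The torsion equation for e^+ ties x to the N-entry of plus type, the one for e^-
    ties 1 + s m' to the other; star compatibility makes their product 1.\<close>
  have XN: "x = q ^ 4 * (1 + s * n)"
    by (simp add: x_def m_def s_def algebra_simps power4_eq_xxxx power2_eq_square)
  have "q ^ 4 * (1 + s * m') = q ^ 4 + s * (n' + q ^ 2 + 1)"
    using q by (simp add: m'_def field_simps)
  also have "\<dots> = 1 + s * n'"
    by (simp add: s_def algebra_simps power4_eq_xxxx power2_eq_square)
  finally have "q ^ 4 * (1 + s * m') = 1 + s * n'" .
  moreover have "(1 + s * m') * x = (q ^ 4 * (1 + s * m')) * (1 + s * n)" by (simp add: XN)
  ultimately have inverse: "(1 + s * m') * x = 1" using N by simp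
  then have x0: "x \<noteq> 0" by auto
  have "s * (m' * x + m) = (1 + s * m') * x - (x - s * m)" by (simp add: algebra_simps)
  also have "\<dots> = 0" by (simp add: inverse) (simp add: x_def)
  finally have "s * (m' * x + m) = 0" .
  then have "m' * x = - m" using s by (simp add: eq_neg_iff_add_eq_0)
  then have mX: "m' = - m / x" using x0 by (metis nonzero_eq_divide_eq)
  have m_eq: "m = (x - 1) / s" using s by (simp add: x_def)
  have root: "metric_root q g x"
  proof -
    \<comment> \<open>The quadratic is regrouped so that x - 1 = s m and the torsion equation
      \<open>quad\<close> can be inserted; what is left is a multiple of m + m' x = 0.\<close>
    have "g Plus * x ^ 2 - (g Plus - g Minus - q ^ 2 * s * g Zero) * x - g Minus
      = (x - 1) * (g Plus * x + g Minus) + s * x * (q ^ 2 * g Zero)"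
      by (simp add: algebra_simps power2_eq_square)
    also have "\<dots> = s * m * (g Plus * x + g Minus) + s * x * (g Minus * m' - g Plus * m)"
      by (simp add: quad x_def)
    also have "\<dots> = s * g Minus * (m + m' * x)" by (simp add: algebra_simps)
    also have "\<dots> = 0" using x0 by (simp add: mX)
    finally show ?thesis by (simp add: metric_root_def s_def)
  qed
  have "r * s * (r * s + 2) = 0" using R by (simp add: algebra_simps)
  then have "r = 0 \<or> r * s = - 2" using s by (auto simp: eq_neg_iff_add_eq_0)
  then have r': "r = 0 \<or> r = - 2 / (1 - q ^ 2)"
    using s by (auto simp: s_def[symmetric] field_simps)
  have "c k = of_real (solution q g r x k)" for k
  proof (cases k)
    case Coeff_n_plus
    then show ?thesis using q by (simp add: n m_eq[unfolded s_def, symmetric] m_def)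
  next
    case Coeff_n_minus
    have "q ^ 4 * m' = n' + q ^ 2 + 1" using q by (simp add: m'_def)
    then show ?thesis unfolding Coeff_n_minus n' solution.simps m_eq[unfolded s_def,
        symmetric] mX[symmetric]
      by simp
  qed (simp_all only: r nu mu m m' solution.simps m_eq[unfolded s_def, symmetric] mX[symmetric])
  then have "D = solution_nabla q g r x" unfolding c by (metis ext)
  with that root r' show thesis by blast
qed


end

section \<open>The two roots and the limit q \<rightarrow> 1\<close>

lemma eventually_generic_q: "\<forall>\<^sub>F q in at (1::real). q \<noteq> 0 \<and> q ^ 2 \<noteq> 1"
proof -
  have "\<forall>\<^sub>F q in at (1::real). q > 0"
    by (rule order_tendstoD(1)[OF tendsto_ident_at]) simp
  moreover have "\<forall>\<^sub>F q in at (1::real). q \<noteq> 1"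
    by (simp add: eventually_at_filter)
  ultimately show ?thesis
    by eventually_elim (auto simp: power2_eq_1_iff)
qed

definition upper_root :: "(idx \<Rightarrow> real) \<Rightarrow> real \<Rightarrow> real" where
  "upper_root g q = (let b = g Plus - g Minus - q ^ 2 * (1 - q ^ 2) * g Zero in
     (b + sqrt (b ^ 2 + 4 * g Plus * g Minus)) / (2 * g Plus))"

definition lower_root :: "(idx \<Rightarrow> real) \<Rightarrow> real \<Rightarrow> real" where
  "lower_root g q = (let b = g Plus - g Minus - q ^ 2 * (1 - q ^ 2) * g Zero in
     (b - sqrt (b ^ 2 + 4 * g Plus * g Minus)) / (2 * g Plus))"

context
  fixes g :: "idx \<Rightarrow> real"
  assumes g: "\<And>i. g i > 0"
begin

text \<open>The product g_++ g_-- is positive, so the discriminant exceeds b^2; this forces the two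
  roots to have opposite signs.\<close>

lemma abs_less_sqrt_discriminant: "\<bar>b\<bar> < sqrt (b ^ 2 + 4 * g Plus * g Minus)"
  using g[of Plus] g[of Minus] by (intro real_less_rsqrt) simp

lemma upper_root_pos: "upper_root g q > 0"
  using abs_less_sqrt_discriminant[of "g Plus - g Minus - q ^ 2 * (1 - q ^ 2) * g Zero"] g[of Plus]
  by (auto simp: upper_root_def Let_def intro!: divide_pos_pos)

lemma lower_root_neg: "lower_root g q < 0"
  using abs_less_sqrt_discriminant[of "g Plus - g Minus - q ^ 2 * (1 - q ^ 2) * g Zero"] g[of Plus]
  by (auto simp: lower_root_def Let_def intro!: divide_neg_pos)

lemma metric_root_iff: "metric_root q g x \<longleftrightarrow> x = upper_root g q \<or> x = lower_root g q"
proof -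
  define b where "b = g Plus - g Minus - q ^ 2 * (1 - q ^ 2) * g Zero"
  define t where "t = sqrt (b ^ 2 + 4 * g Plus * g Minus)"
  have t: "t ^ 2 = b ^ 2 + 4 * g Plus * g Minus"
    using g[of Plus] g[of Minus] by (simp add: t_def)
  have g0: "g Plus \<noteq> 0" using g[of Plus] by simp
  have u: "2 * g Plus * upper_root g q = b + t" and l: "2 * g Plus * lower_root g q = b - t"
    using g0 by (simp_all add: upper_root_def lower_root_def Let_def b_def t_def)
  have "4 * g Plus * (g Plus * x ^ 2 - b * x - g Minus)
      = (2 * g Plus * x - (b + t)) * (2 * g Plus * x - (b - t))"
    using t by (simp add: algebra_simps power2_eq_square)
  also have "\<dots> = 4 * g Plus ^ 2 * ((x - upper_root g q) * (x - lower_root g q))"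
    unfolding u[symmetric] l[symmetric] by (simp add: algebra_simps power2_eq_square)
  finally have "g Plus * x ^ 2 - b * x - g Minus = 0 \<longleftrightarrow> (x - upper_root g q) * (x - lower_root g q)
      = 0"
    using g0 by (metis mult_eq_0_iff power_not_zero zero_neq_numeral)
  then show ?thesis by (simp add: metric_root_def b_def)
qed

text \<open>Two values of r and two roots x give four pairs, and r and x can be recovered from the
  coefficients r and m_+.\<close>

lemma card_compatible_torsion_free:
  assumes q: "q \<noteq> 0" "q ^ 2 \<noteq> 1"
  shows "card {D \<in> compatible_connections q g. torsion_free q D} = 4"
proof -
  let ?f = "\<lambda>(r, x). solution_nabla q g r x"
  let ?R = "{0, - 2 / (1 - q ^ 2)}" and ?U = "{upper_root g q, lower_root g q}"
  have "{D \<in> compatible_connections q g. torsion_free q D} = ?f ` (?R \<times> ?U)"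
  proof (intro equalityI subsetI)
    fix D assume "D \<in> {D \<in> compatible_connections q g. torsion_free q D}"
    then have D: "D \<in> compatible_connections q g" "torsion_free q D" by auto
    obtain r x where "r = 0 \<or> r = - 2 / (1 - q ^ 2)" "metric_root q g x" "D
        = solution_nabla q g r x"
      by (rule solution_complete[OF q g D]) (rule that)
    then show "D \<in> ?f ` (?R \<times> ?U)" by (auto simp: metric_root_iff)
  next
    fix D assume "D \<in> ?f ` (?R \<times> ?U)"
    then obtain r x where "r = 0 \<or> r = - 2 / (1 - q ^ 2)" "metric_root q g x" "D
        = solution_nabla q g r x"
      by (auto simp: metric_root_iff)
    then show "D \<in> {D \<in> compatible_connections q g. torsion_free q D}"
      using solution_sound[OF q g] by simp
  qed
  moreover have "inj_on ?f (?R \<times> ?U)"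
    by (auto simp: inj_on_def solution_nabla_inject[OF q])
  moreover have "card ?R = 2" using q by simp
  moreover have "card ?U = 2" using upper_root_pos[of q] lower_root_neg[of q] by simp
  ultimately show ?thesis by (simp only: card_image card_cartesian_product)
qed

text \<open>At q = 1 the discriminant is the square of g_++ + g_--, so the positive root equals
  1.\<close>

lemma upper_root_tendsto: "(upper_root g \<longlongrightarrow> 1) (at 1)"
proof -
  have "(g Plus - g Minus) ^ 2 + 4 * g Plus * g Minus = (g Plus + g Minus) ^ 2"
    by (simp add: algebra_simps power2_eq_square)
  then have "sqrt ((g Plus - g Minus) ^ 2 + 4 * g Plus * g Minus) = g Plus + g Minus"
    using g[of Plus] g[of Minus] by simp
  then show ?thesis
    unfolding upper_root_def[abs_def] Let_def using g[of Plus]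
    by (auto intro!: tendsto_eq_intros)
qed

text \<open>Only m_+ = (x - 1) / (1 - q^2) is indeterminate at q = 1; the other coefficients are
  continuous in q, x and m_+.\<close>

lemma solution_tendsto:
  "((\<lambda>q. solution q g 0 (upper_root g q) k) \<longlongrightarrow> limit_coeff g k) (at 1)"
proof -
  have g': "g i \<noteq> 0" for i using g[of i] by simp
  have gg: "g Plus + g Minus \<noteq> 0" using g[of Plus] g[of Minus] by simp
  have "((\<lambda>q. - (q ^ 2 * g Zero * upper_root g q) / (g Plus * upper_root g q + g Minus))
      \<longlongrightarrow> - g Zero / (g Plus + g Minus)) (at 1)"
    using gg by (auto intro!: tendsto_eq_intros upper_root_tendsto)
  moreover have "\<forall>\<^sub>F q in at 1. - (q ^ 2 * g Zero * upper_root g q) / (g Plus * upper_root g q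
      + g Minus)
      = (upper_root g q - 1) / (1 - q ^ 2)"
    using eventually_generic_q
  \<comment> \<open>The quadratic factors x - 1 as a multiple of 1 - q^2, and positivity of the root
    keeps the new denominator away from zero.\<close>
  proof eventually_elim
    case (elim q)
    let ?u = "upper_root g q"
    have "metric_root q g ?u" by (simp add: metric_root_iff)
    then have "(?u - 1) * (g Plus * ?u + g Minus) = - (q ^ 2 * g Zero * ?u) * (1 - q ^ 2)"
      by (simp add: metric_root_def algebra_simps power2_eq_square)
    moreover have "g Plus * ?u + g Minus \<noteq> 0"
      using upper_root_pos[of q] g[of Plus] g[of Minus] by (smt (verit) mult_pos_pos)
    ultimately show ?case using elim by (subst frac_eq_eq) simp_all
  qed
  moreover define m where "m = (\<lambda>q. (upper_root g q - 1) / (1 - q ^ 2))"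
  ultimately have m: "(m \<longlongrightarrow> - g Zero / (g Plus + g Minus)) (at 1)"
    using Lim_transform_eventually by simp
  have solution: "solution q g 0 (upper_root g q) k = (case k of
      Coeff_r \<Rightarrow> 0
    | Coeff_m_plus \<Rightarrow> m q
    | Coeff_m_minus \<Rightarrow> - m q / upper_root g q
    | Coeff_n_plus \<Rightarrow> (m q + q ^ 2 + 1) / q ^ 4
    | Coeff_n_minus \<Rightarrow> q ^ 4 * (- m q / upper_root g q) - (q ^ 2 + 1)
    | Coeff_nu \<Rightarrow> q * g Minus / g Zero * (- m q / upper_root g q)
    | Coeff_mu \<Rightarrow> g Plus / (q * g Zero) * m q)" for q
    by (cases k) (simp_all only: m_def solution.simps coeff.case)
  show ?thesis
    unfolding solution
  proof (cases k)
    case Coeff_m_plus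
    then show "((\<lambda>q. case k of
          Coeff_r \<Rightarrow> 0
        | Coeff_m_plus \<Rightarrow> m q
        | Coeff_m_minus \<Rightarrow> - m q / upper_root g q
        | Coeff_n_plus \<Rightarrow> (m q + q ^ 2 + 1) / q ^ 4
        | Coeff_n_minus \<Rightarrow> q ^ 4 * (- m q / upper_root g q) - (q ^ 2 + 1)
        | Coeff_nu \<Rightarrow> q * g Minus / g Zero * (- m q / upper_root g q)
        | Coeff_mu \<Rightarrow> g Plus / (q * g Zero) * m q) \<longlongrightarrow> limit_coeff g k) (at 1)"
      using m by simp
  qed (use g' gg in \<open>auto intro!: tendsto_eq_intros m upper_root_tendsto\<close>)
qed

text \<open>Convergent coefficients times 1 - q^2 tend to 0. For r = -2/s the product r s has
  absolute value 2, and for the negative root s m_+ = x - 1 has absolute value above 1, so both are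
  excluded near q = 1.\<close>

lemma convergent_solution_unique:
  assumes D: "\<And>q. q \<noteq> 0 \<Longrightarrow> q\<^sup>2 \<noteq> 1 \<Longrightarrow>
      D q \<in> compatible_connections q g \<and> torsion_free q (D q) \<and> has_coeffs q (c q) (D q)"
    and lim: "\<And>k. ((\<lambda>q. c q k) \<longlongrightarrow> L k) (at 1)"
  shows "\<forall>\<^sub>F q in at 1. D q = solution_nabla q g 0 (upper_root g q)"
proof -
  have "((\<lambda>q. c q k * (1 - of_real q ^ 2)) \<longlongrightarrow> L k * (1 - of_real 1 ^ 2)) (at 1)" for k
    by (intro tendsto_intros lim)
  then have "((\<lambda>q. norm (c q k * (1 - of_real q ^ 2))) \<longlongrightarrow> 0) (at 1)" for k
    by (auto intro: tendsto_norm_zero)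
  then have small: "\<forall>\<^sub>F q in at 1. norm (c q k * (1 - of_real q ^ 2)) < 1" for k
    by (rule order_tendstoD(2)) simp
  show ?thesis
    using eventually_generic_q small[of Coeff_r] small[of Coeff_m_plus]
  proof eventually_elim
    case (elim q)
    then have q: "q \<noteq> 0" "q ^ 2 \<noteq> 1" by auto
    have Dq_mem: "D q \<in> compatible_connections q g" "torsion_free q (D q)" using D[OF q] by simp_all
    obtain r x where r: "r = 0 \<or> r = - 2 / (1 - q ^ 2)" and x: "metric_root q g x"
      and Dq: "D q = solution_nabla q g r x"
      by (rule solution_complete[OF q g Dq_mem]) (rule that)
    have c: "c q = (\<lambda>k. of_real (solution q g r x k))"
      using D[OF q] has_coeffs_nabla_iff[OF q(1)] unfolding Dq by blast
    have bound: "\<bar>solution q g r x k * (1 - q ^ 2)\<bar> < 1" if "norm (c q k * (1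
        - of_real q ^ 2)) < 1" for k
    proof -
      have "c q k * (1 - of_real q ^ 2) = of_real (solution q g r x k * (1 - q ^ 2))"
        by (simp add: c)
      then show ?thesis using that by (simp only: norm_of_real)
    qed
    have "\<bar>r * (1 - q ^ 2)\<bar> < 1" "\<bar>x - 1\<bar> < 1"
      using bound[of Coeff_r] bound[of Coeff_m_plus] elim q by simp_all
    moreover from this(1) have "r = 0" using r q by auto
    ultimately show ?case
      using x lower_root_neg[of q] by (auto simp: Dq metric_root_iff)
  qed
qed

end

theorem theorem6p2p3:
  fixes g :: "idx \<Rightarrow> real"
  assumes "\<And>i. g i > 0"
  shows
    "(\<forall>q. q \<noteq> 0 \<and> q\<^sup>2 \<noteq> 1 \<longrightarrow>
        card {D \<in> compatible_connections q g. torsion_free q D} = 4) \<and>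
     (\<exists>D c L.
        (\<forall>q. q \<noteq> 0 \<and> q\<^sup>2 \<noteq> 1 \<longrightarrow>
           D q \<in> compatible_connections q g \<and> torsion_free q (D q) \<and>
           has_coeffs q (c q) (D q) \<and> c q Coeff_r = 0 \<and>
           (\<forall>D' c'. D' \<in> compatible_connections q g \<and> torsion_free q D' \<and> has_coeffs q c' D' \<and>
              c' Coeff_r = 0 \<and> c' Coeff_n_plus = c q Coeff_n_plus \<longrightarrow> D' = D q)) \<and>
        (\<forall>k. ((\<lambda>q. c q k) \<longlongrightarrow> L k) (at 1)) \<and>
        (\<forall>D' c' L'.
           (\<forall>q. q \<noteq> 0 \<and> q\<^sup>2 \<noteq> 1 \<longrightarrow>
              D' q \<in> compatible_connections q g \<and> torsion_free q (D' q) \<and> has_coeffs q (c' q) (D' q)) \<and>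
           (\<forall>k. ((\<lambda>q. c' q k) \<longlongrightarrow> L' k) (at 1)) \<longrightarrow>
           (\<forall>\<^sub>F q in at 1. D' q = D q)) \<and>
        (g Plus = g Minus \<longrightarrow>
           (\<exists>D\<^sub>1. {D'. levi_civita g D'} = {D\<^sub>1} \<and> has_coeffs 1 L D\<^sub>1)))"
\<comment> \<open>The witness is the family with r = 0 and the positive root, which is defined for
  every admissible q, negative ones included.\<close>
proof (intro conjI allI impI exI[of _ "\<lambda>q. solution_nabla q g 0 (upper_root g q)"]
    exI[of _ "\<lambda>q k. complex_of_real (solution q g 0 (upper_root g q) k)"]
    exI[of _ "\<lambda>k. complex_of_real (limit_coeff g k)"])
  fix q :: real assume "q \<noteq> 0 \<and> q\<^sup>2 \<noteq> 1"
  then have q: "q \<noteq> 0" "q ^ 2 \<noteq> 1" by auto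
  show "card {D \<in> compatible_connections q g. torsion_free q D} = 4"
    using card_compatible_torsion_free[of g, OF assms q] .
  have root: "metric_root q g (upper_root g q)" by (simp add: metric_root_iff[of g, OF assms])
  show "solution_nabla q g 0 (upper_root g q) \<in> compatible_connections q g"
    "torsion_free q (solution_nabla q g 0 (upper_root g q))"
    using solution_sound[of q g, OF q assms _ root] by auto
  show "has_coeffs q (\<lambda>k. complex_of_real (solution q g 0 (upper_root g q) k)) (solution_nabla q g
      0 (upper_root g q))"
    by (rule nabla_has_coeffs[OF q(1)])
  show "complex_of_real (solution q g 0 (upper_root g q) Coeff_r) = 0" by simp
  fix D' c'
  assume *: "D' \<in> compatible_connections q g \<and> torsion_free q D' \<and> has_coeffs q c' D' \<and>
    c' Coeff_r = 0 \<and> c' Coeff_n_plus = complex_of_real (solution q g 0 (upper_root g q)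
        Coeff_n_plus)"
  then have "D' \<in> compatible_connections q g" "torsion_free q D'" by auto
  then obtain r x where D': "D' = solution_nabla q g r x"
    by (rule solution_complete[OF q assms]) (rule that)
  have c': "c' = (\<lambda>k. complex_of_real (solution q g r x k))"
    using * has_coeffs_nabla_iff[OF q(1)] unfolding D' by blast
  have "solution q g r x Coeff_r = 0"
    "solution q g r x Coeff_n_plus = solution q g 0 (upper_root g q) Coeff_n_plus"
    using * unfolding c' of_real_eq_iff of_real_eq_0_iff by blast+
  \<comment> \<open>For fixed q the coefficient n_+ is an injective affine function of x.\<close>
  then have "r = 0" "x = upper_root g q" using q by (simp_all add: divide_cancel_right)
  then show "D' = solution_nabla q g 0 (upper_root g q)" by (simp add: D')
next
  fix k
  show "((\<lambda>q. complex_of_real (solution q g 0 (upper_root g q) k)) \<longlongrightarrow> complex_of_real (limit_coeff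
      g k)) (at 1)"
    by (intro tendsto_of_real solution_tendsto assms)
next
  fix D' c' L'
  assume "(\<forall>q. q \<noteq> 0 \<and> q\<^sup>2 \<noteq> 1 \<longrightarrow>
      D' q \<in> compatible_connections q g \<and> torsion_free q (D' q) \<and> has_coeffs q (c' q) (D' q)) \<and>
    (\<forall>k. ((\<lambda>q. c' q k) \<longlongrightarrow> L' k) (at 1))"
  then show "\<forall>\<^sub>F q in at 1. D' q = solution_nabla q g 0 (upper_root g q)"
    by (intro convergent_solution_unique[of g D' c' L'] assms) auto
next
  assume "g Plus = g Minus"
  then show "\<exists>D\<^sub>1. {D'. levi_civita g D'} = {D\<^sub>1} \<and> has_coeffs 1 (\<lambda>k. complex_of_real (limit_coeff
      g k)) D\<^sub>1"
    using levi_civita_eq[of g, OF assms] nabla_has_coeffs[of 1] by auto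
qed

end
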